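(* Let $G$ be a finite simple planar graph with girth $g(G)\geq 8$ and maximum degree $\Delta(G)\geq 6$. Then $G$ admits a $2$-distance $(\Delta(G)+2)$-coloring.
   Context: For a finite simple graph $G$, $\Delta(G)$ is its maximum degree and $g(G)$ is its girth, i.e. the length of a shortest cycle. A $2$-distance $k$-coloring of $G$ is a map $\phi:V(G)\to\{1,\dots,k\}$ such that $\phi(x)\neq\phi(y)$ for any two distinct vertices $x,y$ at distance at most $2$ in $G$. *)

theory Defs
  imports "HOL-Analysis.Analysis" "Graph_Theory.Shortest_Path"
begin

text \<open>
  Finite simple graphs are the symmetric digraphs of the locale \<^locale>\<open>graph\<close>: an
  undirected edge is a pair of opposite arcs. Hence the degree of a vertex is its
  out-degree, and the graph distance is the shortest-path distance for unit weights.
\<close>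

text \<open>The element 0 only serves to give the null graph maximum degree 0.\<close>
definition max_degree :: "('a, 'b) pre_digraph \<Rightarrow> nat" where
  "max_degree G = Max (insert 0 (out_degree G ` verts G))"

definition graph_dist :: "('a, 'b) pre_digraph \<Rightarrow> 'a \<Rightarrow> 'a \<Rightarrow> ereal" where
  "graph_dist G u v = wf_digraph.\<mu> G (\<lambda>_. 1) u v"

text \<open>
  A pair of opposite arcs is a directed cycle of length 2 but not a cycle of the
  underlying undirected graph; in a simple graph, directed cycles of length at least 3
  are exactly the (oriented) undirected cycles. Forests have girth \<open>\<infinity>\<close>.
\<close>
definition girth :: "('a, 'b) pre_digraph \<Rightarrow> enat" where
  "girth G = (INF p \<in> {p. pre_digraph.cycle G p \<and> 3 \<le> length p}. enat (length p))"

text \<open>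
  A drawing in the plane without crossings: \<open>f\<close> places the vertices, and \<open>c a\<close> is the
  simple curve drawn for \<open>a\<close>. Opposite arcs represent one edge, so they share their curve.
\<close>
definition plane_drawing ::
    "('a, 'b) pre_digraph \<Rightarrow> ('a \<Rightarrow> complex) \<Rightarrow> ('b \<Rightarrow> real \<Rightarrow> complex) \<Rightarrow> bool" where
  "plane_drawing G f c \<longleftrightarrow>
     inj_on f (verts G) \<and>
     (\<forall>a \<in> arcs G.
        Path_Connected.arc (c a) \<and>
        pathstart (c a) = f (tail G a) \<and> pathfinish (c a) = f (head G a) \<and>
        path_image (c a) \<inter> f ` verts G = {f (tail G a), f (head G a)}) \<and>
     (\<forall>a \<in> arcs G. \<forall>b \<in> arcs G.
        tail G b = head G a \<and> head G b = tail G a \<longrightarrow> c b = reversepath (c a)) \<and>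
     (\<forall>a \<in> arcs G. \<forall>b \<in> arcs G.
        {tail G a, head G a} \<noteq> {tail G b, head G b} \<longrightarrow>
        path_image (c a) \<inter> path_image (c b) \<subseteq> f ` verts G)"

definition planar :: "('a, 'b) pre_digraph \<Rightarrow> bool" where
  "planar G \<longleftrightarrow> (\<exists>f c. plane_drawing G f c)"

definition two_distance_coloring ::
    "('a, 'b) pre_digraph \<Rightarrow> nat \<Rightarrow> ('a \<Rightarrow> nat) \<Rightarrow> bool" where
  "two_distance_coloring G k \<phi> \<longleftrightarrow>
     \<phi> ` verts G \<subseteq> {1..k} \<and>
     (\<forall>x \<in> verts G. \<forall>y \<in> verts G. x \<noteq> y \<and> graph_dist G x y \<le> 2 \<longrightarrow> \<phi> x \<noteq> \<phi> y)"

end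

theory Submission
  imports Defs
begin

text \<open>
  A plane graph of girth at least 8 is sparse, and sparse graphs are easy to colour.

  Sparseness. Deleting an edge that lies on a cycle merges two faces, by the Jordan curve theorem,
  and this gives the inequality half of Euler's formula (\<open>euler_inequality\<close>). Each edge borders at
  most two faces (\<open>edge_on_at_most_two_faces\<close>), while the edges bordering a face contain a cycle,
  hence number at least 8, as soon as there are two faces: a set of curves without cycles does not
  separate the plane (\<open>few_edges_do_not_separate\<close>). The last two statements come from Janiszewski's
  theorem: two plane compacta with connected intersection that do not separate two points do not
  separate them together. Counting incidences yields \<open>3 * |E| < 4 * |V|\<close>
  for the graph induced by any nonempty vertex set (\<open>planar_girth_8_sparse\<close>), so that the
  average degree is less than 8/3.

  Colouring. Let \<open>k \<ge> 6\<close> bound the degrees and take a vertex-minimal graph that is sparse in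
  this sense but not colourable with \<open>k + 2\<close> colours. Removing a suitable set of vertices and
  colouring the removed vertices greedily shows that some local configurations do not occur:
  vertices of degree at most 1; two adjacent 2-vertices, unless both their other neighbours have
  degree \<open>k\<close>; a 3-vertex with three neighbours of degree 2 (a tripod), unless the three vertices
  behind these have degree \<open>k\<close>; and one type of 3-vertex with two neighbours of degree 2.
  Give each vertex \<open>v\<close> the charge \<open>6 * deg v - 16\<close>, so that sparseness makes the total negative,
  and let vertices of degree at least 3 pay neighbours (\<open>gives\<close>). Everybody then ends with a
  nonnegative charge, except that some 2-vertices, which come in pairs, one pair for two adjacent
  2-vertices and one pair for a tripod, end with -1; vertices of degree \<open>k\<close> keep at least 2.

  So it remains to see that the paired vertices number at most twice the vertices of
  degree \<open>k\<close> (\<open>card_linked_le\<close>). This is a reducibility argument that is not local: if there were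
  more pairs, some pairs would form a subsystem in which every \<open>k\<close>-vertex involved is met exactly
  twice (\<open>paired_core\<close>). After removing that subsystem, each removed vertex has two colours left and
  two conflicts, and the conflicts form disjoint even cycles, which can be coloured from lists
  of size 2 (\<open>two_involutions_choosable\<close>).
\<close>

section \<open>List colouring of the union of two perfect matchings\<close>
text \<open>
  The edges \<open>{x, \<sigma> x}\<close> and \<open>{x, \<tau> x}\<close> form two perfect matchings. They alternate around
  every cycle of their union, which is therefore even.
\<close>
lemma two_involutions_bipartite:
  assumes "finite X"
    and "\<And>x. x \<in> X \<Longrightarrow> \<sigma> x \<in> X \<and> \<sigma> (\<sigma> x) = x \<and> \<sigma> x \<noteq> x"
    and "\<And>x. x \<in> X \<Longrightarrow> \<tau> x \<in> X \<and> \<tau> (\<tau> x) = x \<and> \<tau> x \<noteq> x"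
  shows "\<exists>A. \<forall>x\<in>X. (\<sigma> x \<in> A \<longleftrightarrow> x \<notin> A) \<and> (\<tau> x \<in> A \<longleftrightarrow> x \<notin> A)"
  using assms
proof (induction "card X" arbitrary: X \<tau> rule: less_induct)
  case less
  show ?case
  proof (cases "X = {}")
    case False
    then obtain x where x: "x \<in> X" by blast
    define y where "y = \<sigma> x"
    have y: "y \<in> X" "\<sigma> y = x" "y \<noteq> x" using less.prems(2)[OF x] by (auto simp: y_def)
    define X' where "X' = X - {x, y}"
    define p where "p = \<tau> x"
    define q where "q = \<tau> y"
    have \<sigma>: "\<And>z. z \<in> X \<Longrightarrow> \<sigma> z \<in> X \<and> \<sigma> (\<sigma> z) = z \<and> \<sigma> z \<noteq> z"
      and \<tau>: "\<And>z. z \<in> X \<Longrightarrow> \<tau> z \<in> X \<and> \<tau> (\<tau> z) = z \<and> \<tau> z \<noteq> z"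
      using less.prems by blast+
    have \<sigma>': "\<sigma> z \<in> X' \<and> \<sigma> (\<sigma> z) = z \<and> \<sigma> z \<noteq> z" if "z \<in> X'" for z
      using that \<sigma>[of z] y y_def by (auto simp: X'_def)
    have card: "card X' < card X"
      unfolding X'_def using x less.prems(1) by (intro psubset_card_mono) auto
    have fin: "finite X'" using less.prems(1) by (simp add: X'_def)
    show ?thesis
    proof (cases "p = y")
      case True
      have \<tau>': "\<tau> z \<in> X' \<and> \<tau> (\<tau> z) = z \<and> \<tau> z \<noteq> z" if "z \<in> X'" for z
        using that \<tau>[of z] \<tau>[OF x] True by (auto simp: X'_def p_def)
      obtain A where A: "\<forall>z\<in>X'. (\<sigma> z \<in> A \<longleftrightarrow> z \<notin> A) \<and> (\<tau> z \<in> A \<longleftrightarrow> z \<notin> A)"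
        using less.hyps[OF card fin \<sigma>' \<tau>'] by blast
      have "\<forall>z\<in>X. (\<sigma> z \<in> insert x (A - {y}) \<longleftrightarrow> z \<notin> insert x (A - {y}))
                 \<and> (\<tau> z \<in> insert x (A - {y}) \<longleftrightarrow> z \<notin> insert x (A - {y}))"
      proof
        fix z assume "z \<in> X"
        then consider "z = x" | "z = y" | "z \<in> X'" by (auto simp: X'_def)
        then show "(\<sigma> z \<in> insert x (A - {y}) \<longleftrightarrow> z \<notin> insert x (A - {y}))
                 \<and> (\<tau> z \<in> insert x (A - {y}) \<longleftrightarrow> z \<notin> insert x (A - {y}))"
        proof cases
          case 1 then show ?thesis using y y_def True p_def by auto
        next
          case 2 then show ?thesis using y y_def True p_def \<tau>[OF x] by auto
        next
          case 3 then show ?thesis using \<sigma>'[OF 3] \<tau>'[OF 3] A by (auto simp: X'_def)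
        qed
      qed
      then show ?thesis by blast
    next
      case False
      have pq: "p \<in> X'" "q \<in> X'" "p \<noteq> q" "\<tau> p = x" "\<tau> q = y"
        using \<tau>[OF x] \<tau>[OF y(1)] False y by (auto simp: X'_def p_def q_def)
      \<comment> \<open>Suppressing the path \<open>p, x, y, q\<close> to an edge \<open>p, q\<close> preserves the parity of the cycle.\<close>
      define \<tau>' where "\<tau>' = \<tau>(p := q, q := p)"
      have \<tau>': "\<tau>' z \<in> X' \<and> \<tau>' (\<tau>' z) = z \<and> \<tau>' z \<noteq> z" if z: "z \<in> X'" for z
      proof (cases "z = p \<or> z = q")
        case True then show ?thesis using pq by (auto simp: \<tau>'_def)
      next
        case F: False
        have zX: "z \<in> X" "z \<noteq> x" "z \<noteq> y" using z by (auto simp: X'_def)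
        have "\<tau> z \<noteq> x" "\<tau> z \<noteq> y" using F \<tau>[OF zX(1)] by (auto simp: p_def q_def)
        moreover have "\<tau> z \<noteq> p" "\<tau> z \<noteq> q" using \<tau>[OF zX(1)] pq zX by auto
        ultimately show ?thesis using F \<tau>[OF zX(1)] by (auto simp: \<tau>'_def X'_def)
      qed
      obtain A where A: "\<forall>z\<in>X'. (\<sigma> z \<in> A \<longleftrightarrow> z \<notin> A) \<and> (\<tau>' z \<in> A \<longleftrightarrow> z \<notin> A)"
        using less.hyps[OF card fin \<sigma>' \<tau>'] by blast
      have Apq: "q \<in> A \<longleftrightarrow> p \<notin> A" using A pq by (auto simp: \<tau>'_def split: if_splits)
      define B where "B = (if p \<in> A then insert y (A - {x}) else insert x (A - {y}))"
      have BX: "z \<in> B \<longleftrightarrow> z \<in> A" if "z \<in> X'" for z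
        using that by (auto simp: B_def X'_def)
      have Bx: "x \<in> B \<longleftrightarrow> p \<notin> A" and By: "y \<in> B \<longleftrightarrow> p \<in> A" using y by (auto simp: B_def)
      have "\<forall>z\<in>X. (\<sigma> z \<in> B \<longleftrightarrow> z \<notin> B) \<and> (\<tau> z \<in> B \<longleftrightarrow> z \<notin> B)"
      proof
        fix z assume zX: "z \<in> X"
        consider "z = x" | "z = y" | "z \<in> X'" using zX by (auto simp: X'_def)
        then show "(\<sigma> z \<in> B \<longleftrightarrow> z \<notin> B) \<and> (\<tau> z \<in> B \<longleftrightarrow> z \<notin> B)"
        proof cases
          case 1
          then show ?thesis using Bx By BX[OF pq(1)] by (simp flip: y_def p_def)
        next
          case 2
          then show ?thesis using Bx By BX[OF pq(2)] Apq y by (simp flip: q_def)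
        next
          case 3
          have \<sigma>z: "\<sigma> z \<in> B \<longleftrightarrow> z \<notin> B" using A 3 BX \<sigma>'[OF 3] by blast
          have "\<tau> z \<in> B \<longleftrightarrow> z \<notin> B"
          proof (cases "z = p \<or> z = q")
            case True
            then show ?thesis using pq Bx By BX Apq by auto
          next
            case False
            then have "\<tau>' z = \<tau> z" by (simp add: \<tau>'_def)
            then show ?thesis using A 3 BX \<tau>'[OF 3] by metis
          qed
          with \<sigma>z show ?thesis by blast
        qed
      qed
      then show ?thesis by blast
    qed
  qed simp
qed

text \<open>
  An even cycle, directed around, has one outgoing arc at each vertex; lists of size one more than
  the number of outgoing arcs suffice. The set \<open>A\<close> is one colour class of a bipartition, and the
  weaker bound for vertices whose arc leaves \<open>Y\<close> is what the induction produces.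
\<close>
lemma bipartite_functional_choosable:
  assumes "finite Y"
    and "\<And>y. y \<in> Y \<Longrightarrow> s y \<in> A \<longleftrightarrow> y \<notin> A"
    and "\<And>y. y \<in> Y \<Longrightarrow> finite (L y) \<and> card (L y) \<ge> (if s y \<in> Y then 2 else 1)"
  shows "\<exists>c. \<forall>y\<in>Y. c y \<in> L y \<and> (s y \<in> Y \<longrightarrow> c y \<noteq> c (s y))"
  using assms
proof (induction "card Y" arbitrary: Y L rule: less_induct)
  case less
  note fin = less.prems(1) and par = less.prems(2) and lists = less.prems(3)
  show ?case
  proof (cases "\<exists>y\<in>Y. \<exists>p\<in>L y. s y \<in> Y \<longrightarrow> p \<notin> L (s y)")
    case True
    \<comment> \<open>The colour \<open>p\<close> of \<open>y\<close> cannot reappear at \<open>s y\<close>, so only the vertices whose arc ends in \<open>y\<close>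
      lose it, and these lose that arc as well.\<close>
    then obtain y p where y: "y \<in> Y" "p \<in> L y" "s y \<in> Y \<longrightarrow> p \<notin> L (s y)" by blast
    have card: "card (Y - {y}) < card Y" using y fin by (intro psubset_card_mono) auto
    define L' where "L' z = (if s z = y then L z - {p} else L z)" for z
    have l: "finite (L' z) \<and> card (L' z) \<ge> (if s z \<in> Y - {y} then 2 else 1)" if "z \<in> Y - {y}" for z
      using lists[of z] that y(1) by (auto simp: L'_def card_Diff_singleton_if split: if_splits)
    have "\<exists>c. \<forall>z\<in>Y - {y}. c z \<in> L' z \<and> (s z \<in> Y - {y} \<longrightarrow> c z \<noteq> c (s z))"
      by (rule less.hyps[OF card]) (use fin par l in auto)
    then obtain c where c: "\<And>z. z \<in> Y - {y} \<Longrightarrow> c z \<in> L' z"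
      "\<And>z. z \<in> Y - {y} \<Longrightarrow> s z \<in> Y - {y} \<Longrightarrow> c z \<noteq> c (s z)" by blast
    have "s y \<noteq> y" using par[OF y(1)] by auto
    then have sy: "s y \<in> Y \<longrightarrow> c (s y) \<noteq> p"
      using c(1)[of "s y"] y by (auto simp: L'_def split: if_splits)
    show ?thesis
    proof (intro exI ballI)
      fix z assume z: "z \<in> Y"
      show "(c(y := p)) z \<in> L z \<and> (s z \<in> Y \<longrightarrow> (c(y := p)) z \<noteq> (c(y := p)) (s z))"
        using z c[of z] y \<open>s y \<noteq> y\<close> sy by (auto simp: L'_def split: if_splits)
    qed
  next
    case False
    show ?thesis
    proof (cases "Y = {}")
      case False
      then obtain y0 where y0: "y0 \<in> Y" by blast
      have "L y0 \<noteq> {}" using lists[OF y0] by (auto split: if_splits)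
      then obtain p where p: "p \<in> L y0" by blast
      \<comment> \<open>The vertices that may receive \<open>p\<close> are closed under \<open>s\<close>. Giving \<open>p\<close> to those in \<open>A\<close> and
        forbidding it elsewhere costs the remaining ones a colour, but also their outgoing arc.\<close>
      define K where "K = {y \<in> Y. p \<in> L y \<and> y \<in> A}"
      have closed: "s y \<in> Y \<and> p \<in> L (s y)" if "y \<in> Y" "p \<in> L y" for y
        using \<open>\<not> (\<exists>y\<in>Y. \<exists>p\<in>L y. s y \<in> Y \<longrightarrow> p \<notin> L (s y))\<close> that by blast
      have K: "K \<subseteq> Y" "\<And>y. y \<in> K \<Longrightarrow> p \<in> L y" "\<And>y. y \<in> K \<Longrightarrow> s y \<notin> K"
        "\<And>y. y \<in> Y - K \<Longrightarrow> p \<in> L y \<Longrightarrow> s y \<in> K"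
        using par closed by (auto simp: K_def)
      have "y0 \<in> K \<or> s y0 \<in> K" using K(4) y0 p by blast
      then have "K \<noteq> {}" by blast
      then have card: "card (Y - K) < card Y" using K(1) fin by (intro psubset_card_mono) auto
      have l: "finite (L y - {p}) \<and> card (L y - {p}) \<ge> (if s y \<in> Y - K then 2 else 1)"
        if "y \<in> Y - K" for y
      proof (cases "p \<in> L y")
        case True
        then have "s y \<in> Y" "s y \<in> K" using K(1,4) that by auto
        then show ?thesis using lists[of y] that True by (auto simp: card_Diff_singleton)
      next
        case False
        then show ?thesis using lists[of y] that by (auto split: if_splits)
      qed
      have "\<exists>c. \<forall>y\<in>Y - K. c y \<in> L y - {p} \<and> (s y \<in> Y - K \<longrightarrow> c y \<noteq> c (s y))"
        by (rule less.hyps[OF card]) (use fin par l in auto)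
      then obtain c where c: "\<And>y. y \<in> Y - K \<Longrightarrow> c y \<in> L y - {p}"
        "\<And>y. y \<in> Y - K \<Longrightarrow> s y \<in> Y - K \<Longrightarrow> c y \<noteq> c (s y)" by blast
      show ?thesis
      proof (intro exI ballI)
        fix y assume y: "y \<in> Y"
        show "(if y \<in> K then p else c y) \<in> L y \<and> (s y \<in> Y \<longrightarrow>
          (if y \<in> K then p else c y) \<noteq> (if s y \<in> K then p else c (s y)))"
          using y c[of y] c(1)[of "s y"] K(2,3)[of y] by auto
      qed
    qed simp
  qed
qed

text \<open>
  Orienting \<open>\<sigma>\<close>-edges out of one side of the bipartition and \<open>\<tau>\<close>-edges out of the other gives every
  vertex exactly one outgoing arc and every edge a direction.
\<close>
lemma two_involutions_choosable:
  assumes "finite X"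
    and \<sigma>: "\<And>x. x \<in> X \<Longrightarrow> \<sigma> x \<in> X \<and> \<sigma> (\<sigma> x) = x \<and> \<sigma> x \<noteq> x"
    and \<tau>: "\<And>x. x \<in> X \<Longrightarrow> \<tau> x \<in> X \<and> \<tau> (\<tau> x) = x \<and> \<tau> x \<noteq> x"
    and L: "\<And>x. x \<in> X \<Longrightarrow> finite (L x) \<and> card (L x) \<ge> 2"
  shows "\<exists>c. \<forall>x\<in>X. c x \<in> L x \<and> c x \<noteq> c (\<sigma> x) \<and> c x \<noteq> c (\<tau> x)"
proof -
  obtain A where A: "\<forall>x\<in>X. (\<sigma> x \<in> A \<longleftrightarrow> x \<notin> A) \<and> (\<tau> x \<in> A \<longleftrightarrow> x \<notin> A)"
    using two_involutions_bipartite[OF assms(1) \<sigma> \<tau>] by blast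
  define s where "s x = (if x \<in> A then \<sigma> x else \<tau> x)" for x
  have "\<exists>c. \<forall>x\<in>X. c x \<in> L x \<and> (s x \<in> X \<longrightarrow> c x \<noteq> c (s x))"
    by (rule bipartite_functional_choosable[where A = A]) (use assms A L in \<open>auto simp: s_def\<close>)
  then obtain c where c: "\<And>x. x \<in> X \<Longrightarrow> c x \<in> L x" "\<And>x. x \<in> X \<Longrightarrow> c x \<noteq> c (s x)"
    using \<sigma> \<tau> by (metis s_def)
  have "c x \<noteq> c (\<sigma> x) \<and> c x \<noteq> c (\<tau> x)" if x: "x \<in> X" for x
    using c(2)[OF x] c(2)[of "\<sigma> x"] c(2)[of "\<tau> x"] \<sigma>[OF x] \<tau>[OF x] A x
    by (cases "x \<in> A") (auto simp: s_def)
  then show ?thesis using c(1) by blast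
qed

text \<open>
  Read \<open>X\<close> as the set of ends of the edges \<open>{x, \<sigma> x}\<close> of a multigraph on \<open>up ` X\<close>. It has at least as
  many edges as vertices, so it contains a cycle. A minimal nonempty edge set with as many
  edges as vertices has no vertex of degree 1 and no surplus edge, so it is 2-regular.
\<close>
lemma paired_core:
  fixes up :: "'a \<Rightarrow> 'b"
  assumes "finite X" "X \<noteq> {}"
    and "\<And>x. x \<in> X \<Longrightarrow> \<sigma> x \<in> X \<and> \<sigma> (\<sigma> x) = x \<and> \<sigma> x \<noteq> x"
    and "card X \<ge> 2 * card (up ` X)"
  shows "\<exists>Y\<subseteq>X. Y \<noteq> {} \<and> \<sigma> ` Y \<subseteq> Y \<and> (\<forall>y\<in>Y. card {z \<in> Y. up z = up y} = 2)"
  using assms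
proof (induction "card X" arbitrary: X rule: less_induct)
  case less
  note fin = less.prems(1) and ne = less.prems(2) and \<sigma> = less.prems(3) and big = less.prems(4)
  have drop: ?case if x: "x \<in> X" and b: "card (X - {x, \<sigma> x}) \<ge> 2 * card (up ` (X - {x, \<sigma> x}))"
    and n: "X - {x, \<sigma> x} \<noteq> {}" for x
  proof -
    have "card (X - {x, \<sigma> x}) < card X" using x fin by (intro psubset_card_mono) auto
    then have "\<exists>Y\<subseteq>X - {x, \<sigma> x}. Y \<noteq> {} \<and> \<sigma> ` Y \<subseteq> Y \<and> (\<forall>y\<in>Y. card {z \<in> Y. up z = up y} = 2)"
    proof (rule less.hyps)
      fix z assume z: "z \<in> X - {x, \<sigma> x}"
      then have "\<sigma> z \<noteq> x" "\<sigma> z \<noteq> \<sigma> x" using \<sigma>[of z] \<sigma>[OF x] by auto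
      then show "\<sigma> z \<in> X - {x, \<sigma> x} \<and> \<sigma> (\<sigma> z) = z \<and> \<sigma> z \<noteq> z"
        using z \<sigma>[of z] by auto
    qed (use fin n b in auto)
    then show ?thesis by blast
  qed
  have cd: "card (X - {x, \<sigma> x}) = card X - 2" if "x \<in> X" for x
    using \<sigma>[OF that] that fin by (subst card_Diff_subset) auto
  have fib: "card {z \<in> X. up z = a} \<ge> 1" if "a \<in> up ` X" for a
    using that fin by (auto simp: Suc_le_eq card_gt_0_iff)
  have sum: "card X = (\<Sum>a\<in>up ` X. card {z \<in> X. up z = a})"
    using sum.image_gen[OF fin, of "\<lambda>_. 1::nat" up] by simp
  show ?case
  proof (cases "\<exists>x\<in>X. {z \<in> X. up z = up x} = {x}")
    case True
    \<comment> \<open>A vertex of degree 1 can be removed together with its edge.\<close>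
    then obtain x where x: "x \<in> X" "{z \<in> X. up z = up x} = {x}" by blast
    have u: "up ` (X - {x, \<sigma> x}) \<subseteq> up ` X - {up x}" using x by auto
    have "card (up ` (X - {x, \<sigma> x})) \<le> card (up ` X) - 1"
      using card_mono[OF _ u] fin x by (simp add: card_Diff_singleton)
    moreover have "X - {x, \<sigma> x} \<noteq> {}"
    proof
      assume "X - {x, \<sigma> x} = {}"
      then have X: "X = {x, \<sigma> x}" using x \<sigma>[OF x(1)] by blast
      have ne: "\<sigma> x \<noteq> x" "\<sigma> x \<in> X" using \<sigma>[OF x(1)] by blast+
      have "card {x, \<sigma> x} = 2" using ne(1) by simp
      then have "card X = 2" by (simp only: X)
      then have c: "card (up ` X) \<le> 1" using big by linarith
      have u: "up x \<noteq> up (\<sigma> x)"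
      proof
        assume "up x = up (\<sigma> x)"
        then have "\<sigma> x \<in> {z \<in> X. up z = up x}" using ne by simp
        then show False using x(2) ne(1) by blast
      qed
      have "card {up x, up (\<sigma> x)} \<le> card (up ` X)"
        using fin x(1) ne(2) by (intro card_mono) auto
      then show False using c u by simp
    qed
    moreover have "card (up ` X) \<ge> 1" using fin ne by (simp add: Suc_le_eq card_gt_0_iff)
    ultimately have "2 * card (up ` (X - {x, \<sigma> x})) \<le> card (X - {x, \<sigma> x})"
      using cd[OF x(1)] big by linarith
    then show ?thesis using drop[OF x(1)] \<open>X - {x, \<sigma> x} \<noteq> {}\<close> by blast
  next
    case False
    have two: "card {z \<in> X. up z = a} \<ge> 2" if "a \<in> up ` X" for a
    proof (rule ccontr)
      assume "\<not> ?thesis"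
      then have "card {z \<in> X. up z = a} = 1" using fib[OF that] by simp
      then obtain x where x: "{z \<in> X. up z = a} = {x}" by (rule card_1_singletonE)
      then have "x \<in> {z \<in> X. up z = a}" by simp
      then have "x \<in> X" "a = up x" by simp_all
      then show False using False x by simp
    qed
    show ?thesis
    proof (cases "card X \<ge> 2 * card (up ` X) + 2")
      case True
      \<comment> \<open>There is a surplus edge, and any edge can be removed.\<close>
      obtain x where x: "x \<in> X" using ne by blast
      have "card (up ` (X - {x, \<sigma> x})) \<le> card (up ` X)" using fin by (intro card_mono) auto
      moreover have "card (up ` X) \<ge> 1" using fin ne by (simp add: Suc_le_eq card_gt_0_iff)
      ultimately have "2 \<le> card (X - {x, \<sigma> x})" "2 * card (up ` (X - {x, \<sigma> x})) \<le> card (X - {x, \<sigma> x})"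
        using cd[OF x] True by linarith+
      moreover from this have "X - {x, \<sigma> x} \<noteq> {}" by (metis card.empty not_numeral_le_zero)
      ultimately show ?thesis using drop[OF x] by blast
    next
      case F2: False
      \<comment> \<open>By parity there is no surplus, so degrees are 2 on average, and none is smaller.\<close>
      have "even (card X)"
      proof -
        have "\<exists>n. card Z = 2 * n" if "Z \<subseteq> X" "\<sigma> ` Z \<subseteq> Z" for Z
          using finite_subset[OF that(1) fin] that
        proof (induction "card Z" arbitrary: Z rule: less_induct)
          case (less Z)
          show ?case
          proof (cases "Z = {}")
            case False
            then obtain z where z: "z \<in> Z" by blast
            then have sz: "\<sigma> z \<in> Z" "\<sigma> z \<noteq> z" "\<sigma> (\<sigma> z) = z" using less.prems \<sigma>[of z] by auto
            have "card (Z - {z, \<sigma> z}) < card Z" using z less.prems by (intro psubset_card_mono) auto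
            moreover have "\<sigma> ` (Z - {z, \<sigma> z}) \<subseteq> Z - {z, \<sigma> z}"
            proof (rule image_subsetI)
              fix y assume y: "y \<in> Z - {z, \<sigma> z}"
              then have "\<sigma> (\<sigma> y) = y" "\<sigma> y \<in> Z" using less.prems \<sigma>[of y] by auto
              then show "\<sigma> y \<in> Z - {z, \<sigma> z}" using y sz by auto
            qed
            ultimately obtain n where "card (Z - {z, \<sigma> z}) = 2 * n"
              using less.hyps less.prems by (meson Diff_subset finite_Diff subset_trans)
            moreover have "card (Z - {z, \<sigma> z}) = card Z - 2" "card Z \<ge> 2"
              using z sz less.prems card_mono[of Z "{z, \<sigma> z}"] by (auto simp: card_Diff_subset)
            ultimately have "card Z = 2 * (n + 1)" by simp
            then show ?thesis by blast
          qed simp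
        qed
        then show ?thesis using \<sigma> by (metis dvd_def image_subsetI order_refl)
      qed
      then have eq: "card X = 2 * card (up ` X)" using F2 big by presburger
      have "card {z \<in> X. up z = a} = 2" if a: "a \<in> up ` X" for a
      proof (rule ccontr)
        assume "card {z \<in> X. up z = a} \<noteq> 2"
        then have "(\<Sum>a\<in>up ` X. 2) < (\<Sum>a\<in>up ` X. card {z \<in> X. up z = a})"
          using two a fin by (intro sum_strict_mono_ex1) (auto simp: nat_less_le intro!: bexI[of _ a])
        then show False using sum eq by simp
      qed
      then show ?thesis using ne \<sigma> by (intro exI[of _ X]) auto
    qed
  qed
qed

section \<open>Partial colourings\<close>
text \<open>
  A graph is a symmetric relation together with a vertex set; other vertex sets give the induced
  subgraphs.
\<close>
definition nbhd :: "('a \<Rightarrow> 'a \<Rightarrow> bool) \<Rightarrow> 'a set \<Rightarrow> 'a \<Rightarrow> 'a set" where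
  "nbhd E V v = {u \<in> V. E v u}"

definition near :: "('a \<Rightarrow> 'a \<Rightarrow> bool) \<Rightarrow> 'a set \<Rightarrow> 'a \<Rightarrow> 'a set" where
  "near E V x = {y \<in> V. y \<noteq> x \<and> (E x y \<or> (\<exists>z\<in>V. E x z \<and> E z y))}"

text \<open>
  Only the vertices of \<open>D\<close> carry colours, but conflicts are those of the whole graph on \<open>V\<close>: two
  vertices of \<open>D\<close> may be in conflict because of a common neighbour outside \<open>D\<close>.
\<close>
definition partial_coloring :: "('a \<Rightarrow> 'a \<Rightarrow> bool) \<Rightarrow> 'a set \<Rightarrow> nat \<Rightarrow> 'a set \<Rightarrow> ('a \<Rightarrow> nat) \<Rightarrow> bool" where
  "partial_coloring E V m D \<phi> \<longleftrightarrow> (\<forall>x\<in>D. \<phi> x < m \<and> (\<forall>y\<in>D \<inter> near E V x. \<phi> x \<noteq> \<phi> y))"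

definition colorable :: "('a \<Rightarrow> 'a \<Rightarrow> bool) \<Rightarrow> 'a set \<Rightarrow> nat \<Rightarrow> bool" where
  "colorable E V m \<longleftrightarrow> (\<exists>\<phi>. partial_coloring E V m V \<phi>)"

lemma nbhd_subset: "nbhd E V v \<subseteq> V"
  by (auto simp: nbhd_def)

lemma near_commute:
  assumes "symp E" "x \<in> V" "y \<in> V"
  shows "y \<in> near E V x \<longleftrightarrow> x \<in> near E V y"
  using assms unfolding near_def symp_def by blast

lemma partial_coloring_insert:
  assumes "symp E" "finite V" "partial_coloring E V m D \<phi>" "D \<subseteq> V" "x \<in> V" "card (near E V x \<inter> D) < m"
  shows "\<exists>\<phi>'. partial_coloring E V m (insert x D) \<phi>'"
proof -
  have fin: "finite (near E V x \<inter> D)" using assms(2,4) by (meson finite_Int finite_subset)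
  have "card (\<phi> ` (near E V x \<inter> D)) < card {..<m}"
    using card_image_le[OF fin, of \<phi>] assms(6) by simp
  then have "\<not> {..<m} \<subseteq> \<phi> ` (near E V x \<inter> D)"
    using fin by (meson card_mono finite_imageI not_less)
  then obtain c where c: "c < m" "c \<notin> \<phi> ` (near E V x \<inter> D)" by auto
  have "partial_coloring E V m (insert x D) (\<phi>(x := c))"
    unfolding partial_coloring_def
  proof (intro ballI conjI)
    fix y assume y: "y \<in> insert x D"
    show "(\<phi>(x := c)) y < m" using y c assms(3) by (auto simp: partial_coloring_def)
    fix z assume z: "z \<in> insert x D \<inter> near E V y"
    have yz: "y \<noteq> z" "y \<in> V" "z \<in> V" using z y assms(4,5) by (auto simp: near_def)
    have zy: "y \<in> near E V z" using near_commute[OF assms(1)] yz z by blast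
    show "(\<phi>(x := c)) y \<noteq> (\<phi>(x := c)) z"
      using y z zy yz c assms(3) by (auto simp: partial_coloring_def)
  qed
  then show ?thesis by blast
qed

text \<open>
  Removing vertices may also remove conflicts between the remaining ones. The condition says that
  no removed vertex is the midpoint of a path between two remaining vertices.
\<close>
lemma partial_coloring_remove:
  assumes "colorable E (V - R) m"
    and "\<And>r a b. r \<in> R \<Longrightarrow> a \<in> V - R \<Longrightarrow> b \<in> V - R \<Longrightarrow> E a r \<Longrightarrow> E r b \<Longrightarrow> a = b"
  shows "\<exists>\<phi>. partial_coloring E V m (V - R) \<phi>"
proof -
  obtain \<phi> where \<phi>: "partial_coloring E (V - R) m (V - R) \<phi>" using assms(1) by (auto simp: colorable_def)
  have "(V - R) \<inter> near E V x \<subseteq> near E (V - R) x" if "x \<in> V - R" for x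
    using that assms(2) unfolding near_def by blast
  then have "partial_coloring E V m (V - R) \<phi>" using \<phi> by (fastforce simp: partial_coloring_def near_def)
  then show ?thesis by blast
qed

lemma near_subset_Un: "near E V x \<subseteq> (\<Union>y\<in>nbhd E V x. insert y (nbhd E V y - {x}))"
  by (auto simp: near_def nbhd_def)

lemma sum_neighbours_swap:
  fixes t :: "'a \<Rightarrow> 'a \<Rightarrow> 'c::comm_monoid_add"
  assumes "symp E" "finite V"
  shows "(\<Sum>v\<in>V. \<Sum>y\<in>nbhd E V v. t v y) = (\<Sum>v\<in>V. \<Sum>y\<in>nbhd E V v. t y v)"
proof -
  have "(\<Sum>v\<in>V. \<Sum>y\<in>nbhd E V v. t v y) = (\<Sum>y\<in>V. \<Sum>v | v \<in> V \<and> E v y. t v y)"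
    unfolding nbhd_def by (rule sum.swap_restrict) (use assms in auto)
  also have "\<dots> = (\<Sum>y\<in>V. \<Sum>v\<in>nbhd E V y. t v y)"
    unfolding nbhd_def using assms(1) by (intro sum.cong refl) (auto simp: symp_def)
  finally show ?thesis .
qed

section \<open>Configurations absent from a minimal uncolourable graph\<close>
locale minimal_uncolorable =
  fixes E :: "'a \<Rightarrow> 'a \<Rightarrow> bool" and V :: "'a set" and k :: nat
  assumes sym: "symp E" and irr: "\<not> E x x"
    and finV: "finite V"
    and deg_le: "v \<in> V \<Longrightarrow> card (nbhd E V v) \<le> k"
    and k6: "6 \<le> k"
    and uncol: "\<not> colorable E V (k + 2)"
    and minimal: "W \<subset> V \<Longrightarrow> colorable E W (k + 2)"
begin

abbreviation N :: "'a \<Rightarrow> 'a set" where "N v \<equiv> nbhd E V v"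
abbreviation S :: "'a \<Rightarrow> 'a set" where "S v \<equiv> near E V v"
definition d :: "'a \<Rightarrow> nat" where "d v = card (N v)"

definition extendable :: "'a set \<Rightarrow> bool" where
  "extendable D \<longleftrightarrow> D \<subseteq> V \<and> (\<exists>\<phi>. partial_coloring E V (k + 2) D \<phi>)"

lemma finN [simp]: "finite (N v)"
  using finV nbhd_subset finite_subset by metis

lemma N_V: "u \<in> N v \<Longrightarrow> u \<in> V"
  by (simp add: nbhd_def)

lemma N_sym: "u \<in> N v \<Longrightarrow> v \<in> V \<Longrightarrow> v \<in> N u"
  using sym by (auto simp: nbhd_def symp_def)

lemma N_irr: "v \<notin> N v"
  using irr by (simp add: nbhd_def)

lemma finS [simp]: "finite (S v)"
  by (rule finite_subset[OF _ finV]) (auto simp: near_def)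

lemma not_extendable_V: "\<not> extendable V"
  using uncol by (auto simp: extendable_def colorable_def)

text \<open>
  Greedy colouring: \<open>B\<close> bounds the coloured vertices in conflict with \<open>x\<close>.
\<close>
lemma extendable_insert:
  assumes "extendable D" "x \<in> V" "S x \<inter> D \<subseteq> B" "finite B" "card B \<le> k + 1"
  shows "extendable (insert x D)"
proof -
  have "card (S x \<inter> D) < k + 2"
    using card_mono[OF assms(4,3)] assms(5) by linarith
  then show ?thesis
    using partial_coloring_insert[OF sym finV] assms(1,2) by (auto simp: extendable_def)
qed

lemma extendable_remove:
  assumes "R \<subseteq> V" "R \<noteq> {}"
    and "\<And>r. r \<in> R \<Longrightarrow> \<exists>a. N r - R \<subseteq> {a}"
  shows "extendable (V - R)"
  unfolding extendable_def
proof (intro conjI partial_coloring_remove)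
  show "colorable E (V - R) (k + 2)" using assms(1,2) by (intro minimal) auto
  fix r a b assume *: "r \<in> R" "a \<in> V - R" "b \<in> V - R" "E a r" "E r b"
  then have "a \<in> N r - R" "b \<in> N r - R" using sym by (auto simp: nbhd_def symp_def)
  then show "a = b" using assms(3)[OF *(1)] by blast
qed auto

lemma card_N_minus: "v \<in> N w \<Longrightarrow> card (N w - {v}) = d w - 1"
  by (simp add: d_def card_Diff_singleton)

lemma near_cases:
  assumes "z \<in> S x" "x \<in> V"
  shows "\<exists>y\<in>N x. z = y \<or> z \<in> N y - {x}"
  using near_subset_Un[of E V x] assms by blast

lemma near_bound2:
  assumes "N x \<subseteq> {p, q}" "x \<in> V"
  shows "S x \<subseteq> {p, q} \<union> (N p - {x}) \<union> (N q - {x})"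
  using near_cases[OF _ assms(2)] assms(1) by blast

text \<open>
  A vertex with at most one neighbour has at most \<open>k\<close> conflicts.
\<close>
lemma d_ge2:
  assumes "v \<in> V"
  shows "d v \<ge> 2"
proof (rule ccontr)
  assume "\<not> ?thesis"
  then have "card (N v) \<le> 1" by (simp add: d_def)
  then obtain w where w: "N v \<subseteq> {w}"
    by (metis card_le_Suc0_iff_eq One_nat_def finN insertCI subsetI)
  have ext: "extendable (V - {v})" using assms w by (intro extendable_remove) auto
  show False
  proof (cases "N v = {}")
    case True
    have "extendable (insert v (V - {v}))"
      by (rule extendable_insert[OF ext assms, of "{}"]) (use near_cases[OF _ assms] True in auto)
    then show False using not_extendable_V assms by (simp add: insert_absorb)
  next
    case False
    then have Nv: "w \<in> N v" "v \<in> N w" using w N_sym assms by blast+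
    have "card (insert w (N w - {v})) \<le> Suc (card (N w - {v}))"
      by (rule card_insert_le_m1) simp_all
    then have "card (insert w (N w - {v})) \<le> k + 1"
      using card_N_minus[OF Nv(2)] deg_le[OF N_V[OF Nv(1)]] by (simp add: d_def)
    then have "extendable (insert v (V - {v}))"
      by (intro extendable_insert[OF ext assms, of "insert w (N w - {v})"])
        (use near_cases[OF _ assms] w in auto)
    then show False using not_extendable_V assms by (simp add: insert_absorb)
  qed
qed

lemma N_two:
  assumes "d v = 2" "u \<in> N v"
  obtains w where "N v = {u, w}" "w \<noteq> u"
proof -
  obtain a b where "N v = {a, b}" "a \<noteq> b" using assms(1) by (auto simp: d_def card_2_iff)
  then show ?thesis using assms(2) that[of a] that[of b] by auto
qed

lemma card_Un_le3: "card ({a, b, c} \<union> A) \<le> 3 + card A"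
  by (rule order_trans[OF card_Un_le]) (simp add: card_insert_if)

lemma card_Un_le2: "card ({a, b} \<union> A) \<le> 2 + card A"
  by (rule order_trans[OF card_Un_le]) (simp add: card_insert_if)

lemma card_Un_le1: "card ({a} \<union> A) \<le> 1 + card A"
  by (rule order_trans[OF card_Un_le]) (simp add: card_insert_if)

text \<open>
  Remove both 2-vertices. If \<open>w\<close> had degree less than \<open>k\<close>, then colouring first \<open>v'\<close> and then \<open>v\<close>,
  each would meet at most \<open>k + 1\<close> forbidden colours.
\<close>
lemma two_path_end_degree:
  assumes "v \<in> V" "d v = 2" "N v = {v', w}" "d v' = 2" "w \<noteq> v'"
  shows "d w = k"
proof (rule ccontr)
  assume "d w \<noteq> k"
  have wV: "w \<in> V" and v'V: "v' \<in> V" using assms(3) N_V by blast+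
  have dw: "d w \<le> k - 1" using deg_le[OF wV] \<open>d w \<noteq> k\<close> by (simp add: d_def)
  have vv: "v \<in> N v'" "v \<in> N w" using N_sym assms by blast+
  obtain w' where w': "N v' = {v, w'}" "w' \<noteq> v" using N_two[OF assms(4) vv(1)] .
  have w'V: "w' \<in> V" "v' \<in> N w'" using w' N_V N_sym v'V by blast+
  have ne: "v \<noteq> v'" using vv N_irr by blast
  have ext: "extendable (V - {v, v'})"
    using assms w' v'V by (intro extendable_remove) auto
  have "extendable (insert v' (V - {v, v'}))"
  proof (rule extendable_insert[OF ext v'V])
    show "S v' \<inter> (V - {v, v'}) \<subseteq> {w, w'} \<union> (N w' - {v'})"
      using near_bound2[OF _ v'V, of v w'] w' assms(3) by auto
    have "d w' \<le> k" "d w' \<ge> 1" using deg_le w'V d_ge2[of w'] by (auto simp: d_def)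
    then show "card ({w, w'} \<union> (N w' - {v'})) \<le> k + 1"
      using card_Un_le2[of w w' "N w' - {v'}"] card_N_minus[OF w'V(2)] by linarith
  qed auto
  moreover have "insert v' (V - {v, v'}) = V - {v}" using v'V ne by auto
  ultimately have ext2: "extendable (V - {v})" by simp
  have "extendable (insert v (V - {v}))"
  proof (rule extendable_insert[OF ext2 assms(1)])
    show "S v \<inter> (V - {v}) \<subseteq> {v', w, w'} \<union> (N w - {v})"
      using near_bound2[OF _ assms(1), of v' w] w' assms(3) by auto
    show "card ({v', w, w'} \<union> (N w - {v})) \<le> k + 1"
      using card_Un_le3[of v' w w' "N w - {v}"] card_N_minus[OF vv(2)] dw k6 by linarith
  qed auto
  then show False using not_extendable_V assms(1) by (simp add: insert_absorb)
qed

text \<open>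
  Remove \<open>u\<close>, \<open>v1\<close> and \<open>v2\<close>. If \<open>w1\<close> had degree at most 5, then \<open>v2\<close>, \<open>v1\<close> and \<open>u\<close> could be
  coloured in this order, with at most \<open>k + 1\<close>, 7 and 7 forbidden colours.
\<close>
lemma light_centre:
  assumes "u \<in> V" "N u = {v1, v2, x}" "v1 \<noteq> v2" "x \<noteq> v1" "x \<noteq> v2" "d v1 = 2" "d v2 = 2"
    and "w1 \<in> N v1" "w1 \<noteq> u" "d x \<le> 3"
  shows "d w1 \<ge> 6"
proof (rule ccontr)
  assume w1: "\<not> ?thesis"
  have inV: "v1 \<in> V" "v2 \<in> V" "x \<in> V" using assms(2) N_V by blast+
  have u1: "u \<in> N v1" "u \<in> N v2" "u \<in> N x" using N_sym assms(1,2) by blast+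
  obtain w where "N v1 = {u, w}" using N_two[OF assms(6) u1(1)] .
  then have N1: "N v1 = {u, w1}" using assms(8,9) by auto
  obtain w2 where N2: "N v2 = {u, w2}" "w2 \<noteq> u" using N_two[OF assms(7) u1(2)] .
  have wV: "w1 \<in> V" "w2 \<in> V" "v1 \<in> N w1" "v2 \<in> N w2"
    using N1 N2 N_V N_sym inV by blast+
  have une: "u \<noteq> v1" "u \<noteq> v2" "u \<noteq> x" using u1 N_irr by blast+
  let ?R = "{u, v1, v2}"
  have ext: "extendable (V - ?R)"
    using assms(1,2) inV N1 N2 by (intro extendable_remove) auto
  have "extendable (insert v2 (V - ?R))"
  proof (rule extendable_insert[OF ext inV(2)])
    show "S v2 \<inter> (V - ?R) \<subseteq> {x, w2} \<union> (N w2 - {v2})"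
      using near_bound2[OF _ inV(2), of u w2] N2 assms(2) by auto
    have "d w2 \<le> k" "d w2 \<ge> 1" using deg_le wV d_ge2[of w2] by (auto simp: d_def)
    then show "card ({x, w2} \<union> (N w2 - {v2})) \<le> k + 1"
      using card_Un_le2[of x w2 "N w2 - {v2}"] card_N_minus[OF wV(4)] by linarith
  qed auto
  moreover have "insert v2 (V - ?R) = V - {u, v1}" using inV une assms(3) by auto
  ultimately have ext2: "extendable (V - {u, v1})" by simp
  have "extendable (insert v1 (V - {u, v1}))"
  proof (rule extendable_insert[OF ext2 inV(1)])
    show "S v1 \<inter> (V - {u, v1}) \<subseteq> {x, v2, w1} \<union> (N w1 - {v1})"
      using near_bound2[OF _ inV(1), of u w1] N1 assms(2) by auto
    show "card ({x, v2, w1} \<union> (N w1 - {v1})) \<le> k + 1"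
      using card_Un_le3[of x v2 w1 "N w1 - {v1}"] card_N_minus[OF wV(3)] w1 k6 by linarith
  qed auto
  moreover have "insert v1 (V - {u, v1}) = V - {u}" using inV une by auto
  ultimately have ext3: "extendable (V - {u})" by simp
  have "extendable (insert u (V - {u}))"
  proof (rule extendable_insert[OF ext3 assms(1)])
    show "S u \<inter> (V - {u}) \<subseteq> {v1, v2, x} \<union> ({w1, w2} \<union> (N x - {u}))"
    proof
      fix z assume "z \<in> S u \<inter> (V - {u})"
      then obtain y where "y \<in> {v1, v2, x}" "z = y \<or> z \<in> N y - {u}"
        using near_cases[of z u] assms(1,2) by blast
      then show "z \<in> {v1, v2, x} \<union> ({w1, w2} \<union> (N x - {u}))" using N1 N2 by auto
    qed
    show "card ({v1, v2, x} \<union> ({w1, w2} \<union> (N x - {u}))) \<le> k + 1"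
      using card_Un_le3[of v1 v2 x "{w1, w2} \<union> (N x - {u})"] card_Un_le2[of w1 w2 "N x - {u}"]
        card_N_minus[OF u1(3)] assms(10) k6 by linarith
  qed auto
  then show False using not_extendable_V assms(1) by (simp add: insert_absorb)
qed

text \<open>
  Remove \<open>u\<close> and its neighbours. If \<open>w1\<close> had degree less than \<open>k\<close>, they could be coloured in the
  order \<open>v2\<close>, \<open>v3\<close>, \<open>v1\<close>, \<open>u\<close>: the missing neighbour of \<open>w1\<close> makes up for \<open>v1\<close> having both \<open>v2\<close> and
  \<open>v3\<close> as conflicts, whereas \<open>v3\<close> has only \<open>v2\<close>.
\<close>
lemma tripod_end_degree:
  assumes "u \<in> V" "N u = {v1, v2, v3}" "v1 \<noteq> v2" "v3 \<noteq> v1" "v3 \<noteq> v2"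
    "d v1 = 2" "d v2 = 2" "d v3 = 2" "w1 \<in> N v1" "w1 \<noteq> u"
  shows "d w1 = k"
proof (rule ccontr)
  assume "d w1 \<noteq> k"
  have inV: "v1 \<in> V" "v2 \<in> V" "v3 \<in> V" using assms(2) N_V by blast+
  have u1: "u \<in> N v1" "u \<in> N v2" "u \<in> N v3" using N_sym assms(1,2) by blast+
  obtain w where "N v1 = {u, w}" using N_two[OF assms(6) u1(1)] .
  then have N1: "N v1 = {u, w1}" using assms(9,10) by auto
  obtain w2 where N2: "N v2 = {u, w2}" "w2 \<noteq> u" using N_two[OF assms(7) u1(2)] .
  obtain w3 where N3: "N v3 = {u, w3}" "w3 \<noteq> u" using N_two[OF assms(8) u1(3)] .
  have wV: "w1 \<in> V" "w2 \<in> V" "w3 \<in> V" "v1 \<in> N w1" "v2 \<in> N w2" "v3 \<in> N w3"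
    using N1 N2 N3 N_V N_sym inV by blast+
  have w1: "d w1 \<le> k - 1" using deg_le[OF wV(1)] \<open>d w1 \<noteq> k\<close> by (simp add: d_def)
  have dw: "d w2 \<le> k" "d w2 \<ge> 1" "d w3 \<le> k" "d w3 \<ge> 1"
    using deg_le wV d_ge2[of w2] d_ge2[of w3] by (auto simp: d_def)
  have une: "u \<noteq> v1" "u \<noteq> v2" "u \<noteq> v3" using u1 N_irr by blast+
  let ?R = "{u, v1, v2, v3}"
  have ext: "extendable (V - ?R)"
    using assms(1,2) inV N1 N2 N3 by (intro extendable_remove) auto
  have "extendable (insert v2 (V - ?R))"
  proof (rule extendable_insert[OF ext inV(2)])
    show "S v2 \<inter> (V - ?R) \<subseteq> {w2} \<union> (N w2 - {v2})"
      using near_bound2[OF _ inV(2), of u w2] N2 assms(2) by auto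
    show "card ({w2} \<union> (N w2 - {v2})) \<le> k + 1"
      using card_Un_le1[of w2 "N w2 - {v2}"] card_N_minus[OF wV(5)] dw by linarith
  qed auto
  moreover have "insert v2 (V - ?R) = V - {u, v1, v3}" using inV une assms by auto
  ultimately have ext2: "extendable (V - {u, v1, v3})" by simp
  have "extendable (insert v3 (V - {u, v1, v3}))"
  proof (rule extendable_insert[OF ext2 inV(3)])
    show "S v3 \<inter> (V - {u, v1, v3}) \<subseteq> {v2, w3} \<union> (N w3 - {v3})"
      using near_bound2[OF _ inV(3), of u w3] N3 assms(2) by auto
    show "card ({v2, w3} \<union> (N w3 - {v3})) \<le> k + 1"
      using card_Un_le2[of v2 w3 "N w3 - {v3}"] card_N_minus[OF wV(6)] dw by linarith
  qed auto
  moreover have "insert v3 (V - {u, v1, v3}) = V - {u, v1}" using inV une assms by auto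
  ultimately have ext3: "extendable (V - {u, v1})" by simp
  have "extendable (insert v1 (V - {u, v1}))"
  proof (rule extendable_insert[OF ext3 inV(1)])
    show "S v1 \<inter> (V - {u, v1}) \<subseteq> {v2, v3, w1} \<union> (N w1 - {v1})"
      using near_bound2[OF _ inV(1), of u w1] N1 assms(2) by auto
    show "card ({v2, v3, w1} \<union> (N w1 - {v1})) \<le> k + 1"
      using card_Un_le3[of v2 v3 w1 "N w1 - {v1}"] card_N_minus[OF wV(4)] w1 k6 by linarith
  qed auto
  moreover have "insert v1 (V - {u, v1}) = V - {u}" using inV une by auto
  ultimately have ext4: "extendable (V - {u})" by simp
  have "extendable (insert u (V - {u}))"
  proof (rule extendable_insert[OF ext4 assms(1)])
    show "S u \<inter> (V - {u}) \<subseteq> {v1, v2, v3} \<union> {w1, w2, w3}"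
    proof
      fix z assume "z \<in> S u \<inter> (V - {u})"
      then obtain y where "y \<in> {v1, v2, v3}" "z = y \<or> z \<in> N y - {u}"
        using near_cases[of z u] assms(1,2) by blast
      then show "z \<in> {v1, v2, v3} \<union> {w1, w2, w3}" using N1 N2 N3 by auto
    qed
    have "card ({v1, v2, v3} \<union> {w1, w2, w3}) \<le> 3 + card {w1, w2, w3}" by (rule card_Un_le3)
    also have "card {w1, w2, w3} \<le> 3" by (simp add: card_insert_if)
    finally show "card ({v1, v2, v3} \<union> {w1, w2, w3}) \<le> k + 1" using k6 by linarith
  qed auto
  then show False using not_extendable_V assms(1) by (simp add: insert_absorb)
qed

section \<open>Pairs of 2-vertices compete for few vertices of maximum degree\<close>
definition tripod :: "'a \<Rightarrow> bool" where
  "tripod u \<longleftrightarrow> u \<in> V \<and> d u = 3 \<and> (\<forall>y\<in>N u. d y = 2)"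

text \<open>
  Of the three neighbours of a tripod's centre, two form a pair.
\<close>
definition spare :: "'a \<Rightarrow> 'a" where
  "spare u = (SOME y. y \<in> N u)"

text \<open>
  Linked vertices are the 2-vertices that discharging leaves with a deficit, and each is linked to
  exactly one other, its mate. The other way out of a linked vertex leads to a vertex of degree \<open>k\<close>, its hub.
\<close>
definition link :: "'a \<Rightarrow> 'a \<Rightarrow> bool" where
  "link y z \<longleftrightarrow> y \<in> V \<and> d y = 2 \<and> z \<noteq> y \<and>
     (d z = 2 \<and> z \<in> N y \<or> (\<exists>u. tripod u \<and> N u - {spare u} = {y, z}))"

definition linked :: "'a set" where
  "linked = {y. \<exists>z. link y z}"

definition mate :: "'a \<Rightarrow> 'a" where
  "mate y = (THE z. link y z)"

definition hub :: "'a \<Rightarrow> 'a" where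
  "hub y = (THE a. a \<in> N y \<and> d a = k)"

lemma spare_in: "tripod u \<Longrightarrow> spare u \<in> N u"
  unfolding spare_def by (rule someI_ex) (metis tripod_def d_def card.empty ex_in_conv zero_neq_numeral)

lemma tripod_other_end:
  assumes "tripod u" "y \<in> N u" "w \<in> N y" "w \<noteq> u"
  shows "d w = k"
proof -
  have "card (N u - {y}) = 2" using assms card_N_minus by (simp add: tripod_def)
  then obtain b c where bc: "N u - {y} = {b, c}" "b \<noteq> c" by (auto simp: card_2_iff)
  then have "N u = {y, b, c}" "y \<noteq> b" "c \<noteq> y" using assms(2) by blast+
  then show ?thesis
    using tripod_end_degree[of u y b c w] assms bc by (auto simp: tripod_def)
qed

lemma link_sym:
  assumes "link y z"
  shows "link z y"
proof -
  have y: "y \<in> V" "d y = 2" "z \<noteq> y" using assms by (auto simp: link_def)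
  consider "d z = 2" "z \<in> N y" | u where "tripod u" "N u - {spare u} = {y, z}"
    using assms by (auto simp: link_def)
  then show ?thesis
  proof cases
    case 1
    then have "z \<in> V" "y \<in> N z" using N_V[of z y] N_sym[of z y] y by blast+
    then show ?thesis unfolding link_def using 1 y by blast
  next
    case 2
    then have "z \<in> N u" by blast
    then have "z \<in> V" "d z = 2" using 2(1) N_V by (auto simp: tripod_def)
    moreover have "N u - {spare u} = {z, y}" using 2(2) by blast
    ultimately show ?thesis using 2(1) y unfolding link_def by blast
  qed
qed

lemma link_cases:
  assumes "link y z"
  obtains a b where "N y = {a, b}" "a \<noteq> b" "d a = k"
    "b = z \<and> d z = 2 \<or> tripod b \<and> N b = {y, z, spare b} \<and> spare b \<notin> {y, z}"
proof -
  have y: "y \<in> V" "d y = 2" "z \<noteq> y" using assms by (auto simp: link_def)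
  consider "d z = 2" "z \<in> N y" | u where "tripod u" "N u - {spare u} = {y, z}"
    using assms by (auto simp: link_def)
  then show ?thesis
  proof cases
    case 1
    obtain a where a: "N y = {z, a}" "a \<noteq> z" using N_two[OF y(2) 1(2)] .
    have "d a = k" using two_path_end_degree[OF y(1,2) a(1) 1(1) a(2)] .
    then show ?thesis using a 1 by (intro that[of a z]) auto
  next
    case 2
    have u: "y \<in> N u" "u \<in> V" using 2 by (auto simp: tripod_def)
    obtain a where a: "N y = {u, a}" "a \<noteq> u" using N_two[OF y(2) N_sym[OF u]] .
    have "d a = k" using tripod_other_end[OF 2(1) u(1), of a] a by blast
    moreover have "N u = {y, z, spare u}" "spare u \<notin> {y, z}"
      using 2(2) spare_in[OF 2(1)] by blast+
    ultimately show ?thesis using a 2 by (intro that[of a u]) auto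
  qed
qed

lemma hub_unique:
  assumes "N y = {a, b}" "d a = k" "d b = 2 \<or> d b = 3"
  shows "hub y = a"
  unfolding hub_def
proof (rule the_equality)
  fix a' assume "a' \<in> N y \<and> d a' = k"
  then show "a' = a" using assms k6 by auto
qed (use assms in auto)

text \<open>
  The neighbour \<open>b\<close> of \<open>y\<close> other than the hub is either the mate itself or the centre of a tripod.
\<close>
lemma link_hub_cases:
  assumes "link y z"
  obtains b where "N y = {hub y, b}" "d (hub y) = k" "hub y \<noteq> b"
    "b = z \<and> d b = 2 \<or> tripod b \<and> N b = {y, z, spare b} \<and> spare b \<notin> {y, z}"
proof -
  obtain a b where ab: "N y = {a, b}" "a \<noteq> b" "d a = k"
    "b = z \<and> d z = 2 \<or> tripod b \<and> N b = {y, z, spare b} \<and> spare b \<notin> {y, z}"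
    using link_cases[OF assms] .
  then have "hub y = a" using hub_unique[OF ab(1,3)] by (auto simp: tripod_def)
  then show ?thesis using ab that by auto
qed

lemma link_unique:
  assumes z: "link y z" and z': "link y z'"
  shows "z' = z"
proof -
  have ne: "z \<noteq> y" "z' \<noteq> y" using z z' by (auto simp: link_def)
  obtain b where b: "N y = {hub y, b}" "d (hub y) = k" "hub y \<noteq> b"
    "b = z \<and> d b = 2 \<or> tripod b \<and> N b = {y, z, spare b} \<and> spare b \<notin> {y, z}"
    using link_hub_cases[OF z] .
  obtain b' where b': "N y = {hub y, b'}" "d (hub y) = k" "hub y \<noteq> b'"
    "b' = z' \<and> d b' = 2 \<or> tripod b' \<and> N b' = {y, z', spare b'} \<and> spare b' \<notin> {y, z'}"
    using link_hub_cases[OF z'] .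
  have "b' = b" using b(1,3) b'(1,3) by (auto simp: doubleton_eq_iff)
  then have "(z = b \<and> z' = b) \<or> (N b - {spare b} = {y, z} \<and> N b - {spare b} = {y, z'})"
    using b(4) b'(4) by (auto simp: tripod_def)
  then show ?thesis using ne by (auto simp: doubleton_eq_iff)
qed

lemma mate_eq: "link y z \<Longrightarrow> mate y = z"
  unfolding mate_def using link_unique by blast

lemma link_mate: "y \<in> linked \<Longrightarrow> link y (mate y)"
  using mate_eq by (auto simp: linked_def)

lemma mate_linked: "y \<in> linked \<Longrightarrow> mate y \<in> linked"
  using link_sym[OF link_mate] by (auto simp: linked_def)

lemma mate_mate: "y \<in> linked \<Longrightarrow> mate (mate y) = y"
  using mate_eq[OF link_sym[OF link_mate]] .

lemma mate_neq: "y \<in> linked \<Longrightarrow> mate y \<noteq> y"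
  using link_mate by (simp add: link_def)

lemmas linked_cases = link_hub_cases[OF link_mate]

lemma hub_facts:
  assumes "y \<in> linked"
  shows "hub y \<in> N y" "d (hub y) = k"
proof -
  obtain b where b: "N y = {hub y, b}" "d (hub y) = k" "hub y \<noteq> b"
    "b = mate y \<and> d b = 2 \<or> tripod b \<and> N b = {y, mate y, spare b} \<and> spare b \<notin> {y, mate y}"
    using linked_cases[OF assms] .
  show "d (hub y) = k" by (rule b(2))
  have "hub y \<in> {hub y, b}" by simp
  then show "hub y \<in> N y" by (simp only: b(1))
qed

lemma linked_degree: "y \<in> linked \<Longrightarrow> y \<in> V \<and> d y = 2"
  by (auto simp: linked_def link_def)

lemma tripod_linked:
  assumes "tripod u" "y \<in> N u" "y \<in> linked"
  shows "N u = {y, mate y, spare u}" "y \<noteq> spare u" "spare u \<notin> linked"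
proof -
  have main: "N u = {x, mate x, spare u} \<and> x \<noteq> spare u" if "x \<in> N u" "x \<in> linked" for x
  proof -
    obtain b where b: "N x = {hub x, b}" "d (hub x) = k" "hub x \<noteq> b"
      "b = mate x \<and> d b = 2 \<or> tripod b \<and> N b = {x, mate x, spare b} \<and> spare b \<notin> {x, mate x}"
      using linked_cases[OF \<open>x \<in> linked\<close>] .
    have "u \<in> N x" "d u = 3" using N_sym[OF \<open>x \<in> N u\<close>] assms(1) by (auto simp: tripod_def)
    then have "u = b" using b(1,2) k6 by auto
    then have "N u = {x, mate x, spare u}" "spare u \<notin> {x, mate x}" using b(4) \<open>d u = 3\<close> by auto
    then show ?thesis by blast
  qed
  show "N u = {y, mate y, spare u}" "y \<noteq> spare u" using main[OF assms(2,3)] by blast+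
  show "spare u \<notin> linked" using main[of "spare u"] spare_in[OF assms(1)] by blast
qed

lemma extendable_Un:
  assumes "finite U" "U \<subseteq> V" "extendable D" "\<And>u. u \<in> U \<Longrightarrow> card (S u) \<le> k + 1"
  shows "extendable (D \<union> U)"
  using assms
proof (induction U rule: finite_induct)
  case (insert u U)
  have "extendable (insert u (D \<union> U))"
    by (rule extendable_insert[where B = "S u"]) (use insert in auto)
  then show ?case by simp
qed simp

text \<open>
  The centre of a tripod has at most 6 conflicts and can be coloured last.
\<close>
lemma tripod_near:
  assumes "tripod u"
  shows "card (S u) \<le> k + 1"
proof -
  have "card (S u) \<le> card (\<Union>y\<in>N u. insert y (N y - {u}))"
    by (rule card_mono[OF _ near_subset_Un]) auto
  also have "\<dots> \<le> (\<Sum>y\<in>N u. card (insert y (N y - {u})))"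
    by (rule card_UN_le) simp
  also have "\<dots> \<le> (\<Sum>y\<in>N u. 2)"
  proof (rule sum_mono)
    fix y assume y: "y \<in> N u"
    have "card (N y - {u}) = 1"
      using card_N_minus[of u y] N_sym[OF y] y assms by (auto simp: tripod_def)
    then show "card (insert y (N y - {u})) \<le> 2"
      using card_insert_le_m1[of 2 "N y - {u}" y] by simp
  qed
  also have "\<dots> = 6" using assms by (simp add: tripod_def d_def)
  finally show ?thesis using k6 by simp
qed

text \<open>
  Remove the vertices of \<open>Y\<close> and the centres of the tripods they belong to. The conflicts of \<open>y\<close>
  inside \<open>Y\<close> are with its mate and with \<open>\<tau> y\<close>, the other vertex of \<open>Y\<close> at the same hub. The
  coloured vertices in conflict with \<open>y\<close> are the hub, its \<open>k - 2\<close> remaining neighbours and one vertex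
  behind the mate or the centre; this leaves two of the \<open>k + 2\<close> colours.
\<close>
lemma no_two_regular_subset:
  assumes "Y \<subseteq> linked" "Y \<noteq> {}" "mate ` Y \<subseteq> Y"
    and fibre: "\<And>y. y \<in> Y \<Longrightarrow> card {z \<in> Y. hub z = hub y} = 2"
  shows False
proof -
  have YV: "y \<in> V" "d y = 2" "y \<in> linked" if "y \<in> Y" for y using linked_degree that assms(1) by auto
  have mY: "mate y \<in> Y" if "y \<in> Y" for y using that assms(3) by blast
  have finY: "finite Y" by (rule finite_subset[OF _ finV]) (use YV in blast)
  define U where "U = {u. tripod u \<and> N u \<inter> Y \<noteq> {}}"
  have UV: "U \<subseteq> V" "finite U" and U2: "\<And>u. u \<in> U \<Longrightarrow> d u = 3"
    by (auto simp: U_def tripod_def intro: finite_subset[OF _ finV])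
  have disj: "U \<inter> Y = {}" using U2 YV by fastforce
  define R where "R = Y \<union> U"
  define \<tau> where "\<tau> y = (THE z. {z \<in> Y. hub z = hub y} = {y, z} \<and> z \<noteq> y)" for y
  have \<tau>: "{z \<in> Y. hub z = hub y} = {y, \<tau> y}" "\<tau> y \<noteq> y" if y: "y \<in> Y" for y
  proof -
    have "\<exists>z. {z \<in> Y. hub z = hub y} = {y, z} \<and> z \<noteq> y"
    proof -
      obtain p q where pq: "{z \<in> Y. hub z = hub y} = {p, q}" "p \<noteq> q"
        using fibre[OF y] by (auto simp: card_2_iff)
      moreover have "y \<in> {z \<in> Y. hub z = hub y}" using y by simp
      ultimately have "y = p \<or> y = q" by simp
      then show ?thesis using pq by (metis insert_commute)
    qed
    then have "\<exists>!z. {z \<in> Y. hub z = hub y} = {y, z} \<and> z \<noteq> y" by (auto simp: doubleton_eq_iff)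
    from theI'[OF this] show "{z \<in> Y. hub z = hub y} = {y, \<tau> y}" "\<tau> y \<noteq> y"
      by (auto simp: \<tau>_def)
  qed
  have \<tau>Y: "\<tau> y \<in> Y" "hub (\<tau> y) = hub y" if y: "y \<in> Y" for y
  proof -
    have "\<tau> y \<in> {z \<in> Y. hub z = hub y}" using \<tau>(1)[OF y] by simp
    then show "\<tau> y \<in> Y" "hub (\<tau> y) = hub y" by simp_all
  qed
  have \<tau>\<tau>: "\<tau> (\<tau> y) = y" if y: "y \<in> Y" for y
  proof -
    have "{y, \<tau> y} = {\<tau> y, \<tau> (\<tau> y)}" using \<tau>(1)[OF y] \<tau>(1)[OF \<tau>Y(1)[OF y]] \<tau>Y(2)[OF y] by simp
    then show ?thesis using \<tau>(2)[OF y] by (auto simp: doubleton_eq_iff)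
  qed
  have \<tau>I: "z = \<tau> y" if "y \<in> Y" "z \<in> Y" "hub z = hub y" "z \<noteq> y" for y z
  proof -
    have "z \<in> {z \<in> Y. hub z = hub y}" using that by simp
    then show ?thesis using \<tau>(1)[OF that(1)] that(4) by simp
  qed
  have hubN: "hub y \<in> N y" "d (hub y) = k" if "y \<in> Y" for y
    using hub_facts[OF YV(3)[OF that]] by simp_all
  have hubU: "hub y \<notin> Y" if "y \<in> Y" for y using hubN[OF that] YV(2)[of "hub y"] k6 by auto
  have hubI: "hub y = a" if y: "y \<in> Y" and a: "a \<in> N y" "d a = k" for y a
  proof -
    obtain b where b: "N y = {hub y, b}" "d (hub y) = k" "hub y \<noteq> b"
      "b = mate y \<and> d b = 2 \<or> tripod b \<and> N b = {y, mate y, spare b} \<and> spare b \<notin> {y, mate y}"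
      using linked_cases[OF YV(3)[OF y]] .
    have "d b \<noteq> k" using b(4) k6 by (auto simp: tripod_def)
    then show ?thesis using a b(1) by auto
  qed
  have inU: "u \<in> U" if "tripod u" "y \<in> Y" "y \<in> N u" for u y
    using that by (auto simp: U_def)
  have Nu: "N u \<subseteq> Y \<union> {spare u}" if u: "u \<in> U" for u
  proof -
    obtain y where "y \<in> N u" "y \<in> Y" "tripod u" using u by (auto simp: U_def)
    then show ?thesis using tripod_linked(1)[of u y] YV mY by auto
  qed
  have out: "\<exists>a. N r - R \<subseteq> {a}" if "r \<in> R" for r
  proof (cases "r \<in> Y")
    case True
    obtain b where b: "N r = {hub r, b}" "d (hub r) = k" "hub r \<noteq> b"
      "b = mate r \<and> d b = 2 \<or> tripod b \<and> N b = {r, mate r, spare b} \<and> spare b \<notin> {r, mate r}"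
      using linked_cases[OF YV(3)[OF True]] .
    then have "b \<in> R" using mY[OF True] inU[OF _ True] by (auto simp: R_def)
    then show ?thesis using b by auto
  next
    case False
    then show ?thesis using Nu that by (auto simp: R_def)
  qed
  have RV: "R \<subseteq> V" "R \<noteq> {}" using YV UV assms(2) by (auto simp: R_def)
  obtain \<phi> where \<phi>: "partial_coloring E V (k + 2) (V - R) \<phi>"
    using extendable_remove[OF RV out] by (auto simp: extendable_def)
  define L where "L y = {..<k + 2} - \<phi> ` (S y - R)" for y
  have L: "finite (L y) \<and> card (L y) \<ge> 2" if y: "y \<in> Y" for y
  proof -
    obtain b where b: "N y = {hub y, b}" "d (hub y) = k" "hub y \<noteq> b"
      "b = mate y \<and> d b = 2 \<or> tripod b \<and> N b = {y, mate y, spare b} \<and> spare b \<notin> {y, mate y}"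
      using linked_cases[OF YV(3)[OF y]] .
    have bR: "b \<in> R" using b mY[OF y] inU[OF _ y] by (auto simp: R_def)
    have yb: "y \<in> N b" "y \<in> N (hub y)" using N_sym b(1) YV(1)[OF y] by blast+
    obtain c where c: "N b - {y} - R \<subseteq> {c}"
    proof (cases "tripod b")
      case True
      then have "b \<in> U" using inU y yb by blast
      then show ?thesis using Nu that[of "spare b"] by (auto simp: R_def)
    next
      case False
      then have "d b = 2" using b by blast
      then obtain w where "N b = {y, w}" using N_two[OF _ yb(1)] by blast
      then show ?thesis using that[of w] by blast
    qed
    have \<tau>h: "\<tau> y \<in> N (hub y)" using N_sym[OF hubN(1)[OF \<tau>Y(1)[OF y]] YV(1)[OF \<tau>Y(1)[OF y]]] \<tau>Y(2)[OF y] by simp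
    have sub: "S y - R \<subseteq> {hub y, c} \<union> (N (hub y) - {y, \<tau> y})"
      using near_bound2[OF equalityD1[OF b(1)] YV(1)[OF y]] bR c \<tau>Y(1)[OF y] by (auto simp: R_def)
    have "card (N (hub y) - {y, \<tau> y}) = k - 2"
      using yb(2) \<tau>h \<tau>(2)[OF y] b(2) by (subst card_Diff_subset) (auto simp: d_def)
    then have "card ({hub y, c} \<union> (N (hub y) - {y, \<tau> y})) \<le> k"
      using card_Un_le2[of "hub y" c "N (hub y) - {y, \<tau> y}"] k6 by linarith
    moreover have "card (S y - R) \<le> card ({hub y, c} \<union> (N (hub y) - {y, \<tau> y}))"
      by (rule card_mono[OF _ sub]) simp
    ultimately have "card (\<phi> ` (S y - R)) \<le> k"
      using card_image_le[of "S y - R" \<phi>] by simp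
    then show ?thesis
      using diff_card_le_card_Diff[of "\<phi> ` (S y - R)" "{..<k + 2}"] by (simp add: L_def)
  qed
  have inv1: "mate y \<in> Y \<and> mate (mate y) = y \<and> mate y \<noteq> y" if "y \<in> Y" for y
    using that mY mate_mate mate_neq YV(3) by blast
  have inv2: "\<tau> y \<in> Y \<and> \<tau> (\<tau> y) = y \<and> \<tau> y \<noteq> y" if "y \<in> Y" for y
    using that \<tau>Y \<tau>\<tau> \<tau>(2) by blast
  have "\<exists>c. \<forall>y\<in>Y. c y \<in> L y \<and> c y \<noteq> c (mate y) \<and> c y \<noteq> c (\<tau> y)"
    by (rule two_involutions_choosable[OF finY]) (rule inv1 inv2 L, assumption)+
  then obtain c where c: "\<And>y. y \<in> Y \<Longrightarrow> c y \<in> L y" "\<And>y. y \<in> Y \<Longrightarrow> c y \<noteq> c (mate y)"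
    "\<And>y. y \<in> Y \<Longrightarrow> c y \<noteq> c (\<tau> y)" by blast
  have nearY: "z = mate y \<or> z = \<tau> y" if y: "y \<in> Y" and z: "z \<in> Y" "z \<in> S y" for y z
  proof -
    have zy: "z \<noteq> y" using z by (simp add: near_def)
    obtain b where b: "N y = {hub y, b}" "d (hub y) = k" "hub y \<noteq> b"
      "b = mate y \<and> d b = 2 \<or> tripod b \<and> N b = {y, mate y, spare b} \<and> spare b \<notin> {y, mate y}"
      using linked_cases[OF YV(3)[OF y]] .
    obtain w where w: "w \<in> N y" "z = w \<or> z \<in> N w - {y}" using near_cases[OF z(2) YV(1)[OF y]] by blast
    show ?thesis
    proof (cases "w = hub y")
      case True
      then have "hub y \<in> N z" using w z hubU[OF y] N_sym[of z "hub y"] N_V[OF w(1)] by auto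
      then have "hub z = hub y" using hubI z hubN[OF y] by blast
      then show ?thesis using \<tau>I y z zy by blast
    next
      case False
      then have wb: "w = b" using w b(1) by simp
      show ?thesis
      proof (cases "tripod b")
        case True
        then have "d b = 3" by (simp add: tripod_def)
        then have zN: "z \<in> N b" using w wb YV(2)[OF z(1)] by auto
        then have "z \<noteq> spare b" using tripod_linked(2)[OF True zN] YV(3)[OF z(1)] by blast
        then show ?thesis using b(4) \<open>d b = 3\<close> zN zy by auto
      next
        case False
        then have bm: "b = mate y" using b by blast
        show ?thesis
        proof (rule ccontr)
          assume "\<not> ?thesis"
          then have "z \<in> N b" "z \<noteq> b" using w wb bm by auto
          moreover have bY: "b \<in> Y" using bm mY[OF y] by simp
          moreover have "y \<in> N b" using N_sym b(1) YV(1)[OF y] by blast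
          moreover have "hub b \<in> N b" "hub b \<noteq> y" using hubN[OF bY] hubU[OF bY] y by auto
          ultimately have "z = hub b" using N_two[OF YV(2)[OF bY] \<open>y \<in> N b\<close>] zy by (metis insertE singletonD)
          then show False using hubU[OF bY] z(1) by simp
        qed
      qed
    qed
  qed
  define \<psi> where "\<psi> x = (if x \<in> Y then c x else \<phi> x)" for x
  have "partial_coloring E V (k + 2) (V - U) \<psi>"
    unfolding partial_coloring_def
  proof (intro ballI conjI)
    fix x assume x: "x \<in> V - U"
    show "\<psi> x < k + 2" using x c(1)[of x] \<phi> by (auto simp: \<psi>_def L_def R_def partial_coloring_def)
    fix z assume z: "z \<in> (V - U) \<inter> S x"
    have xz: "x \<in> S z" using near_commute[OF sym] x z by blast
    have cross: "c x \<noteq> \<phi> z" if "x \<in> Y" "z \<in> V - R" "z \<in> S x" for x z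
      using c(1)[OF that(1)] that by (auto simp: L_def)
    show "\<psi> x \<noteq> \<psi> z"
    proof (cases "x \<in> Y"; cases "z \<in> Y")
      assume "x \<in> Y" "z \<in> Y"
      then show ?thesis using nearY[of x z] z c by (auto simp: \<psi>_def)
    next
      assume "x \<in> Y" "z \<notin> Y"
      then show ?thesis using cross[of x z] z by (auto simp: \<psi>_def R_def)
    next
      assume "x \<notin> Y" "z \<in> Y"
      then show ?thesis using cross[of z x] x xz by (auto simp: \<psi>_def R_def)
    next
      assume "x \<notin> Y" "z \<notin> Y"
      then show ?thesis using x z \<phi> by (auto simp: \<psi>_def R_def partial_coloring_def)
    qed
  qed
  then have "extendable (V - U)" by (auto simp: extendable_def)
  then have "extendable ((V - U) \<union> U)"
    using UV tripod_near by (intro extendable_Un) (auto simp: U_def)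
  then show False using not_extendable_V UV by (simp add: Un_absorb2)
qed

lemma card_linked_le: "card linked \<le> 2 * card {v \<in> V. d v = k}"
proof (cases "linked = {}")
  case False
  have fin: "finite linked" by (rule finite_subset[OF _ finV]) (use linked_degree in blast)
  have "\<not> card linked \<ge> 2 * card (hub ` linked)"
  proof
    assume "card linked \<ge> 2 * card (hub ` linked)"
    with paired_core[OF fin False, of mate hub]
    have "\<exists>Y\<subseteq>linked. Y \<noteq> {} \<and> mate ` Y \<subseteq> Y \<and> (\<forall>y\<in>Y. card {z \<in> Y. hub z = hub y} = 2)"
      using mate_linked mate_mate mate_neq by simp
    then obtain Y where Y: "Y \<subseteq> linked" "Y \<noteq> {}" "mate ` Y \<subseteq> Y"
      "\<forall>y\<in>Y. card {z \<in> Y. hub z = hub y} = 2" by blast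
    show False by (rule no_two_regular_subset[OF Y(1-3)]) (use Y(4) in blast)
  qed
  moreover have "card (hub ` linked) \<le> card {v \<in> V. d v = k}"
  proof (rule card_mono)
    show "hub ` linked \<subseteq> {v \<in> V. d v = k}"
    proof
      fix a assume "a \<in> hub ` linked"
      then obtain y where y: "y \<in> linked" "a = hub y" by blast
      then show "a \<in> {v \<in> V. d v = k}" using hub_facts[OF y(1)] N_V by simp
    qed
  qed (use finV in auto)
  ultimately show ?thesis by linarith
qed simp

section \<open>Discharging\<close>
text \<open>
  A 2-vertex needs 4 units. A vertex of degree at least 6 pays 3 to every neighbour, hence keeps
  \<open>3 * d v - 16 \<ge> 2\<close>; a vertex of degree 4 or 5 can afford 2 per neighbour. A 3-vertex owns
  only 2 units: it pays a 2-neighbour 1 if the neighbour receives 3 from the other side, and 2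
  otherwise, for which it may need support from its third neighbour. A tripod
  spends everything on its spare neighbour and leaves the other two, which are linked, one unit short.
\<close>
definition gives :: "'a \<Rightarrow> 'a \<Rightarrow> int" where
  "gives v y =
     (if 6 \<le> d v then 3
      else if 4 \<le> d v then 2
      else if d v = 3 \<and> d y = 2 then
        (if tripod v then (if y = spare v then 2 else 0)
         else if \<exists>w\<in>N y. w \<noteq> v \<and> 6 \<le> d w then 1 else 2)
      else 0)"

definition final_charge :: "'a \<Rightarrow> int" where
  "final_charge v = 6 * int (d v) - 16 - (\<Sum>y\<in>N v. gives v y) + (\<Sum>y\<in>N v. gives y v)"

lemma gives_nonneg: "0 \<le> gives v y"
  by (simp add: gives_def)

lemma received_nonneg: "0 \<le> (\<Sum>y\<in>N v. gives y v)"
  by (simp add: gives_nonneg sum_nonneg)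

lemma final_charge_ge6:
  assumes "6 \<le> d v"
  shows "2 \<le> final_charge v"
proof -
  have "(\<Sum>y\<in>N v. gives v y) = 3 * int (d v)"
    using assms by (simp add: gives_def d_def)
  then show ?thesis using received_nonneg[of v] assms by (simp add: final_charge_def)
qed

lemma final_charge_45:
  assumes "4 \<le> d v" "d v < 6"
  shows "0 \<le> final_charge v"
proof -
  have "(\<Sum>y\<in>N v. gives v y) = 2 * int (d v)"
    using assms by (simp add: gives_def d_def)
  then show ?thesis using received_nonneg[of v] assms by (simp add: final_charge_def)
qed

text \<open>
  Overspending is possible only with exactly two 2-neighbours. Then either the third neighbour \<open>x\<close>
  has degree at least 4 and contributes 2, or \<open>light_centre\<close> shows that the vertices behind both
  2-neighbours have degree at least 6, and each 2-neighbour costs only 1.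
\<close>
lemma final_charge_3:
  assumes v: "v \<in> V" "d v = 3"
  shows "0 \<le> final_charge v"
proof (cases "tripod v")
  case True
  have "(\<Sum>y\<in>N v. gives v y) = (\<Sum>y\<in>N v. if y = spare v then 2 else 0)"
    using True v by (intro sum.cong) (auto simp: gives_def tripod_def)
  also have "\<dots> = 2" using spare_in[OF True] by (simp add: sum.delta)
  finally show ?thesis using received_nonneg[of v] v by (simp add: final_charge_def)
next
  case False
  define T where "T = {y \<in> N v. d y = 2}"
  have T: "T \<subseteq> N v" "finite T" by (auto simp: T_def)
  have sum_T: "(\<Sum>y\<in>N v. gives v y) = (\<Sum>y\<in>T. gives v y)"
    using v by (intro sum.mono_neutral_right) (auto simp: T_def gives_def)
  have le2: "gives v y \<le> 2" for y using v False by (simp add: gives_def)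
  have bound: "(\<Sum>y\<in>T. gives v y) \<le> 2 * int (card T)"
    using sum_mono[of T "gives v" "\<lambda>_. 2"] le2 by simp
  have "card T \<le> 3" using card_mono[OF finN T(1)] v by (simp add: d_def)
  moreover have "card T \<noteq> 3"
  proof
    assume "card T = 3"
    then have "T = N v" using card_subset_eq[OF finN T(1)] v by (simp add: d_def)
    then show False using False v by (auto simp: tripod_def T_def)
  qed
  ultimately consider "card T \<le> 1" | "card T = 2" by linarith
  then show ?thesis
  proof cases
    case 1
    then show ?thesis using bound sum_T received_nonneg[of v] v by (simp add: final_charge_def)
  next
    case 2
    have "card (N v - T) = 1" using card_Diff_subset[OF T(2,1)] 2 v by (simp add: d_def)
    then obtain x where x: "N v - T = {x}" by (rule card_1_singletonE)
    obtain a b where ab: "T = {a, b}" "a \<noteq> b" using 2 by (auto simp: card_2_iff)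
    have Nv: "N v = {a, b, x}" using x ab T(1) by blast
    have xne: "x \<noteq> a" "x \<noteq> b" using x ab by blast+
    have dab: "d a = 2" "d b = 2" using ab by (auto simp: T_def)
    have "x \<in> N v" "x \<notin> T" using x by blast+
    then have dx: "d x \<noteq> 2" "d x \<ge> 2" "x \<in> V" using d_ge2[OF N_V] N_V by (auto simp: T_def)
    show ?thesis
    proof (cases "d x \<ge> 4")
      case True
      then have "2 \<le> gives x v" by (simp add: gives_def)
      also have "\<dots> \<le> (\<Sum>y\<in>N v. gives y v)"
        by (rule member_le_sum) (use \<open>x \<in> N v\<close> gives_nonneg in auto)
      finally show ?thesis using bound sum_T 2 v by (simp add: final_charge_def)
    next
      case F: False
      then have dx3: "d x \<le> 3" by simp
      have one: "gives v y \<le> 1" if y: "y = a \<and> z = b \<or> y = b \<and> z = a" for y z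
      proof -
        have dy: "d y = 2" "d z = 2" "y \<noteq> z" "x \<noteq> y" "x \<noteq> z" "N v = {y, z, x}"
          using y dab ab xne Nv by auto
        then have "v \<in> N y" using N_sym v(1) by blast
        then obtain w where w: "N y = {v, w}" "w \<noteq> v" using N_two[OF dy(1)] by blast
        have "6 \<le> d w" using light_centre[OF v(1) dy(6,3,4,5,1,2) _ w(2) dx3] w(1) by blast
        then have "\<exists>w\<in>N y. w \<noteq> v \<and> 6 \<le> d w" using w by blast
        then show ?thesis using v False dy by (simp add: gives_def)
      qed
      have "(\<Sum>y\<in>T. gives v y) \<le> 2" using one[of a b] one[of b a] ab by simp
      then show ?thesis using sum_T received_nonneg[of v] v by (simp add: final_charge_def)
    qed
  qed
qed

lemma tripod_nbr_linked:
  assumes "tripod u" "y \<in> N u" "y \<noteq> spare u"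
  shows "y \<in> linked"
proof -
  have "card (N u - {spare u}) = 2" 
    using card_N_minus[OF spare_in[OF assms(1)]] assms(1) by (simp add: tripod_def)
  then obtain p q where pq: "N u - {spare u} = {p, q}" "p \<noteq> q" by (auto simp: card_2_iff)
  have "y \<in> N u - {spare u}" using assms by blast
  then obtain z where "N u - {spare u} = {y, z}" "z \<noteq> y"
    using pq by (metis insertE insert_commute singletonD)
  then show ?thesis
    using assms N_V by (auto simp: linked_def link_def tripod_def)
qed

lemma final_charge_2:
  assumes v: "v \<in> V" "d v = 2"
  shows "(if v \<in> linked then -1 else 0) \<le> final_charge v"
proof -
  obtain p q where pq: "N v = {p, q}" "p \<noteq> q" using v(2) by (auto simp: d_def card_2_iff)
  have final: "final_charge v = gives p v + gives q v - 4"
    using pq v by (simp add: final_charge_def gives_def)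
  have pqV: "p \<in> V" "q \<in> V" "v \<in> N p" "v \<in> N q" using pq N_V N_sym v(1) by blast+
  have both: "(if v \<in> linked then -1 else 0) \<le> gives a v + gives b v - 4"
    if ab: "N v = {a, b}" "a \<noteq> b" "d b \<le> d a" for a b
  proof -
    have abV: "a \<in> V" "b \<in> V" "v \<in> N a" "v \<in> N b" using ab N_V N_sym v(1) by blast+
    have d2: "d a \<ge> 2" "d b \<ge> 2" using abV d_ge2 by auto
    consider "d b = 2" | "d b \<ge> 3" "d a \<ge> 6" | "d b \<ge> 3" "d a < 6" using d2 by linarith
    then show ?thesis
    proof cases
      case 1
      have Nv: "N v = {b, a}" using ab(1) by blast
      have "d a = k" using two_path_end_degree[OF v Nv 1 ab(2)] .
      then have "gives a v = 3" using k6 by (simp add: gives_def)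
      moreover have "link v b" using v 1 ab(1) N_irr[of v] unfolding link_def by auto
      then have "v \<in> linked" by (auto simp: linked_def)
      ultimately show ?thesis using gives_nonneg[of b v] by simp
    next
      case 2
      then have a3: "gives a v = 3" by (simp add: gives_def)
      show ?thesis
      proof (cases "tripod b \<and> v \<noteq> spare b")
        case True
        then have "v \<in> linked" using tripod_nbr_linked abV by blast
        then show ?thesis using a3 gives_nonneg[of b v] by simp
      next
        case False
        then have "1 \<le> gives b v" using 2 v by (auto simp: gives_def)
        then show ?thesis using a3 by simp
      qed
    next
      case 3
      have two: "gives c v = 2" if c: "c = a \<and> e = b \<or> c = b \<and> e = a" for c e
      proof -
        have ce: "N v = {c, e}" "e \<noteq> c" "3 \<le> d c" "d c < 6" "d e < 6" "v \<in> N c" "e \<in> N v"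
          using c ab 3 abV by auto
        have "\<not> tripod c" using tripod_other_end[OF _ ce(6,7,2)] ce(5) k6 by auto
        moreover have "\<not> (\<exists>w\<in>N v. w \<noteq> c \<and> 6 \<le> d w)" using ce by auto
        ultimately show ?thesis using ce v by (auto simp: gives_def)
      qed
      show ?thesis using two[of a b] two[of b a] by simp
    qed
  qed
  have qp: "N v = {q, p}" "q \<noteq> p" using pq by auto
  show ?thesis
    using both[OF pq] both[OF qp] final by (cases "d q \<le> d p") auto
qed

lemma sum_final_charge:
  "(\<Sum>v\<in>V. final_charge v) = (\<Sum>v\<in>V. 6 * int (d v) - 16)"
  using sum_neighbours_swap[OF sym finV, of gives]
  by (simp add: final_charge_def sum.distrib sum_subtractf)

text \<open>
  The deficits of the linked vertices are covered by the 2 units left at each vertex of degree \<open>k\<close>.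
\<close>
lemma degree_sum_ge: "8 * card V \<le> 3 * (\<Sum>v\<in>V. d v)"
proof -
  let ?K = "{v \<in> V. d v = k}"
  have "(if v \<in> ?K then 2 else 0) - (if v \<in> linked then 1 else 0) \<le> final_charge v" if v: "v \<in> V" for v
  proof -
    have nl: "v \<notin> linked" if "d v \<noteq> 2" using that linked_degree by blast
    consider "d v = 2" | "d v = 3" | "4 \<le> d v" "d v < 6" | "6 \<le> d v" using d_ge2[OF v] by linarith
    then show ?thesis
    proof cases
      case 1 then show ?thesis using final_charge_2[OF v] k6 by auto
    next
      case 2 then show ?thesis using final_charge_3[OF v] k6 nl by auto
    next
      case 3 then show ?thesis using final_charge_45[of v] k6 nl by auto
    next
      case 4 then show ?thesis using final_charge_ge6[of v] nl by auto
    qed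
  qed
  then have "(\<Sum>v\<in>V. (if v \<in> ?K then 2 else 0) - (if v \<in> linked then 1 else 0)) \<le> (\<Sum>v\<in>V. final_charge v)"
    by (rule sum_mono)
  moreover have "(\<Sum>v\<in>V. (if v \<in> ?K then 2 else 0) - (if v \<in> linked then 1 else 0)) =
      2 * int (card ?K) - int (card linked)"
  proof -
    have "V \<inter> linked = linked" "V \<inter> ?K = ?K" using linked_degree by blast+
    then show ?thesis
      by (simp only: sum_subtractf sum.If_cases[OF finV] Collect_mem_eq) simp
  qed
  moreover have "0 \<le> 2 * int (card ?K) - int (card linked)" using card_linked_le by simp
  ultimately have "0 \<le> (\<Sum>v\<in>V. 6 * int (d v) - 16)" using sum_final_charge by linarith
  also have "\<dots> = 6 * int (\<Sum>v\<in>V. d v) - 16 * int (card V)"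
    by (simp add: sum_subtractf sum_distrib_left)
  finally show ?thesis by linarith
qed

end

text \<open>
  The sparseness condition says that every induced subgraph has average degree less than 8/3. It is
  inherited by induced subgraphs, which makes a minimal counterexample available.
\<close>
theorem sparse_colorable:
  fixes E :: "'a \<Rightarrow> 'a \<Rightarrow> bool"
  assumes "symp E" "\<And>x. \<not> E x x" "finite V" "6 \<le> k"
    and "\<And>v. v \<in> V \<Longrightarrow> card (nbhd E V v) \<le> k"
    and "\<And>W. W \<subseteq> V \<Longrightarrow> W \<noteq> {} \<Longrightarrow> 3 * (\<Sum>v\<in>W. card (nbhd E W v)) < 8 * card W"
  shows "colorable E V (k + 2)"
  using assms(3,5,6)
proof (induction "card V" arbitrary: V rule: less_induct)
  case less
  note fin = less.prems(1) and deg = less.prems(2) and sparse = less.prems(3)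
  show ?case
  proof (rule ccontr)
    assume unc: "\<not> colorable E V (k + 2)"
    interpret minimal_uncolorable E V k
    proof
      fix W assume W: "W \<subset> V"
      show "colorable E W (k + 2)"
      proof (rule less.hyps)
        show "card W < card V" by (rule psubset_card_mono[OF fin W])
        show "finite W" using W fin by (meson finite_subset psubset_imp_subset)
        fix v assume "v \<in> W"
        then have "card (nbhd E V v) \<le> k" using deg W by blast
        moreover have "card (nbhd E W v) \<le> card (nbhd E V v)"
          using W fin by (intro card_mono) (auto simp: nbhd_def)
        ultimately show "card (nbhd E W v) \<le> k" by linarith
      next
        fix U assume "U \<subseteq> W" "U \<noteq> {}"
        then show "3 * (\<Sum>v\<in>U. card (nbhd E U v)) < 8 * card U" using sparse[of U] W by blast
      qed
    qed (use assms fin deg unc in auto)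
    have "V \<noteq> {}" using unc by (auto simp: colorable_def partial_coloring_def)
    then show False using sparse[of V] degree_sum_ge by (simp add: d_def)
  qed
qed

section \<open>Arcs in the plane\<close>
text \<open>
  A disc stays connected when a point is removed, whereas removing an interior point of an
  arc separates the earlier points from the later ones.
\<close>
lemma arc_image_open_subset_empty:
  fixes g :: "real \<Rightarrow> complex"
  assumes "arc g" "open U" "U \<subseteq> path_image g"
  shows "U = {}"
proof (rule ccontr)
  assume "U \<noteq> {}"
  then obtain x r where r: "0 < r" "ball x r \<subseteq> U"
    using assms(2) by (meson ex_in_conv open_contains_ball)
  have g: "continuous_on {0..1} g" "inj_on g {0..1}"
    using assms(1) by (auto simp: arc_def path_def)
  define T where "T = {t \<in> {0..1}. g t \<in> ball x r}"
  have gT: "g ` T = ball x r"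
    using r assms(3) by (fastforce simp: T_def path_image_def)
  \<comment> \<open>Three parameters \<open>a < s < b\<close> with values in the disc: its points other than \<open>g s\<close> are separated.\<close>
  have "infinite T"
  proof
    assume "finite T"
    then have "finite (ball x r)" using gT by (metis finite_imageI)
    moreover have "ball x r \<noteq> {}" using r(1) by simp
    ultimately show False using finite_imp_not_open open_ball by metis
  qed
  then obtain F where F: "F \<subseteq> T" "finite F" "card F = 3"
    using infinite_arbitrarily_large by blast
  define a b where "a = Min F" and "b = Max F"
  have ab: "a \<in> F" "b \<in> F" "\<And>t. t \<in> F \<Longrightarrow> a \<le> t \<and> t \<le> b"
    using F by (auto simp: a_def b_def intro!: Min_in Max_in)
  have "\<not> F \<subseteq> {a, b}" using F card_mono[of "{a, b}" F] by (auto simp: card_insert_if split: if_splits)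
  then obtain s where s: "s \<in> F" "a < s" "s < b" using ab(3) by force
  have abs01: "a \<in> {0..1}" "b \<in> {0..1}" "s \<in> {0..1}" "g a \<in> ball x r" "g b \<in> ball x r"
    using F ab s by (auto simp: T_def)
  have "connected (ball x r - {g s})"
    by (rule connected_open_delete) auto
  moreover have "closed (g ` {0..s})" "closed (g ` {s..1})"
    using abs01 by (auto intro!: compact_imp_closed compact_continuous_image continuous_on_subset[OF g(1)])
  moreover have "ball x r - {g s} \<subseteq> g ` {0..s} \<union> g ` {s..1}"
  proof
    fix y assume "y \<in> ball x r - {g s}"
    then have "y \<in> g ` T" using gT by blast
    then obtain t where "t \<in> {0..1}" "y = g t" by (auto simp: T_def)
    then show "y \<in> g ` {0..s} \<union> g ` {s..1}" by (cases "t \<le> s") auto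
  qed
  moreover have "g ` {0..s} \<inter> g ` {s..1} \<inter> (ball x r - {g s}) = {}"
  proof -
    have "g t = g s" if "t \<in> {0..s}" "u \<in> {s..1}" "g t = g u" for t u
      using inj_onD[OF g(2) that(3)] that abs01(3) by auto
    then show ?thesis by blast
  qed
  moreover have "g a \<in> g ` {0..s} \<inter> (ball x r - {g s})"
    using abs01 s inj_onD[OF g(2), of a s] by force
  moreover have "g b \<in> g ` {s..1} \<inter> (ball x r - {g s})"
    using abs01 s inj_onD[OF g(2), of b s] by force
  ultimately show False unfolding connected_closed by blast
qed

lemma connected_arc_minus_endpoints:
  fixes g :: "real \<Rightarrow> 'a::metric_space"
  assumes "arc g" "path_image g \<inter> Z \<subseteq> {pathstart g, pathfinish g}"
  shows "connected (path_image g - Z)"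
proof -
  have g: "continuous_on {0..1} g" "inj_on g {0..1}"
    using assms(1) by (auto simp: arc_def path_def)
  define I where "I = {t \<in> {0..1}. g t \<notin> Z}"
  have mid: "t \<in> I" if "0 < t" "t < 1" for t
  proof -
    have "g t \<noteq> g 0" "g t \<noteq> g 1" using that inj_onD[OF g(2), of t 0] inj_onD[OF g(2), of t 1] by auto
    moreover have "g t \<in> path_image g" using that by (simp add: path_image_def)
    ultimately have "g t \<notin> Z" using assms(2) by (auto simp: pathstart_def pathfinish_def)
    then show ?thesis using that by (simp add: I_def)
  qed
  have "is_interval I"
    unfolding is_interval_1
  proof (intro ballI allI impI)
    fix a b t assume ab: "a \<in> I" "b \<in> I" "a \<le> t \<and> t \<le> b"
    then have "0 \<le> a" "b \<le> 1" by (auto simp: I_def)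
    then show "t \<in> I" using ab mid[of t] by (cases "t = a \<or> t = b") auto
  qed
  then have "connected (g ` I)"
    by (intro connected_continuous_image continuous_on_subset[OF g(1)])
      (auto simp: is_interval_connected_1 I_def)
  moreover have "g ` I = path_image g - Z" by (auto simp: I_def path_image_def)
  ultimately show ?thesis by simp
qed

text \<open>
  Functions stand for the partitions into their fibres: a coarser partition has fewer classes, and
  strictly fewer if two classes are merged. It is applied to the partition of the vertices into
  components of the graph when an edge is added.
\<close>
lemma card_image_coarser:
  assumes "finite A" "\<And>x y. x \<in> A \<Longrightarrow> y \<in> A \<Longrightarrow> f x = f y \<Longrightarrow> g x = g y"
  shows "card (g ` A) \<le> card (f ` A)"
    and "x \<in> A \<Longrightarrow> y \<in> A \<Longrightarrow> g x = g y \<Longrightarrow> f x \<noteq> f y \<Longrightarrow> card (g ` A) < card (f ` A)"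
proof -
  define h where "h c = g (SOME x. x \<in> A \<and> f x = c)" for c
  have h: "h (f x) = g x" if "x \<in> A" for x
  proof -
    define z where "z = (SOME z. z \<in> A \<and> f z = f x)"
    have "z \<in> A \<and> f z = f x"
      unfolding z_def by (rule someI[where x = x]) (use that in simp)
    then have "g z = g x" using assms(2) that by blast
    then show ?thesis by (simp only: h_def z_def)
  qed
  have img: "g ` A = h ` f ` A" unfolding image_image by (rule image_cong) (simp_all add: h)
  show le: "card (g ` A) \<le> card (f ` A)"
    unfolding img using assms(1) by (intro card_image_le) simp
  assume xy: "x \<in> A" "y \<in> A" "g x = g y" "f x \<noteq> f y"
  have "card (h ` f ` A) \<noteq> card (f ` A)"
  proof
    assume "card (h ` f ` A) = card (f ` A)"
    then have "inj_on h (f ` A)" using assms(1) by (intro eq_card_imp_inj_on) auto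
    moreover have "h (f x) = h (f y)" using xy h by simp
    ultimately show False using xy inj_onD[of h "f ` A" "f x" "f y"] by blast
  qed
  then show "card (g ` A) < card (f ` A)" using le img by simp
qed

lemma card_le_2_bool:
  assumes "inj_on (P :: 'a \<Rightarrow> bool) S"
  shows "finite S" "card S \<le> 2"
proof -
  show "finite S" using assms by (rule inj_on_finite[of _ _ UNIV]) auto
  show "card S \<le> 2" using card_inj_on_le[OF assms, of UNIV] by simp
qed

section \<open>Plane graphs\<close>
text \<open>
  Vertices stay abstract and are placed by \<open>pos\<close>; an edge is the two-element set of its ends, and
  \<open>im\<close> assigns the drawn curve to it.
\<close>
locale plane_graph =
  fixes P :: "'v set" and pos :: "'v \<Rightarrow> complex"
    and ES :: "'v set set" and im :: "'v set \<Rightarrow> complex set"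
  assumes finP: "finite P" and inj_pos: "inj_on pos P" and finES: "finite ES"
    and edge: "e \<in> ES \<Longrightarrow> \<exists>p q g. p \<in> P \<and> q \<in> P \<and> p \<noteq> q \<and> e = {p, q} \<and> arc g \<and>
        pathstart g = pos p \<and> pathfinish g = pos q \<and> path_image g = im e"
    and im_pos: "e \<in> ES \<Longrightarrow> im e \<inter> pos ` P = pos ` e"
    and crossing: "e \<in> ES \<Longrightarrow> e' \<in> ES \<Longrightarrow> e \<noteq> e' \<Longrightarrow> im e \<inter> im e' \<subseteq> pos ` P"
begin

text \<open>
  Vertices are not part of the drawing of an edge set: isolated vertices would only
  puncture faces.
\<close>
definition drawn :: "'v set set \<Rightarrow> complex set" where
  "drawn H = (\<Union>e\<in>H. im e)"

definition faces :: "'v set set \<Rightarrow> complex set set" where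
  "faces H = components (- drawn H)"

definition joined :: "'v set set \<Rightarrow> 'v \<Rightarrow> 'v \<Rightarrow> bool" where
  "joined H p q \<longleftrightarrow> (p, q) \<in> {(a, b). {a, b} \<in> H}\<^sup>*"

lemma edge_subset: "e \<in> ES \<Longrightarrow> e \<subseteq> P"
  using edge by blast

lemma compact_im: "e \<in> ES \<Longrightarrow> compact (im e)"
  using edge compact_arc_image by metis

lemma compact_drawn: "H \<subseteq> ES \<Longrightarrow> compact (drawn H)"
  unfolding drawn_def using compact_im finES by (intro compact_UN) (auto intro: finite_subset)

lemma closed_drawn: "H \<subseteq> ES \<Longrightarrow> closed (drawn H)"
  by (simp add: compact_drawn compact_imp_closed)

lemma drawn_insert: "drawn (insert e H) = drawn H \<union> im e"
  by (auto simp: drawn_def)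

lemma im_Int_im:
  assumes "e \<in> ES" "e' \<in> ES" "e \<noteq> e'"
  shows "im e \<inter> im e' \<subseteq> pos ` (e \<inter> e')"
proof
  fix x assume x: "x \<in> im e \<inter> im e'"
  then have "x \<in> pos ` P" using crossing[OF assms] by blast
  then have "x \<in> pos ` e" "x \<in> pos ` e'" using x im_pos assms(1,2) by blast+
  then obtain p q where "p \<in> e" "q \<in> e'" "x = pos p" "x = pos q" by blast
  then have "p = q" using inj_onD[OF inj_pos, of p q] edge_subset assms(1,2) by blast
  then show "x \<in> pos ` (e \<inter> e')" using \<open>p \<in> e\<close> \<open>q \<in> e'\<close> \<open>x = pos p\<close> by blast
qed

lemma im_Int_drawn:
  assumes "e \<in> ES" "H \<subseteq> ES" "e \<notin> H"
  shows "im e \<inter> drawn H \<subseteq> pos ` (e \<inter> \<Union>H)"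
proof
  fix x assume "x \<in> im e \<inter> drawn H"
  then obtain e' where e': "e' \<in> H" "x \<in> im e'" "x \<in> im e" by (auto simp: drawn_def)
  then have "x \<in> pos ` (e \<inter> e')" using im_Int_im[of e e'] assms by blast
  then show "x \<in> pos ` (e \<inter> \<Union>H)" using e'(1) by blast
qed

lemma endpoint_in_im: "e \<in> ES \<Longrightarrow> p \<in> e \<Longrightarrow> pos p \<in> im e"
  using im_pos by blast

lemma joined_sym: "joined H p q \<Longrightarrow> joined H q p"
proof -
  have "sym {(a, b). {a, b} \<in> H}" by (auto simp: sym_def insert_commute)
  then show "joined H p q \<Longrightarrow> joined H q p"
    unfolding joined_def by (metis sym_rtrancl symD)
qed

lemma joined_path:
  assumes "H \<subseteq> ES" "joined H p q" "p \<noteq> q"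
  shows "path_component (drawn H) (pos p) (pos q)"
proof -
  have "p = q \<or> path_component (drawn H) (pos p) (pos q)"
    using assms(2) unfolding joined_def
  proof (induction rule: rtrancl_induct)
    case (step y z)
    then have yz: "{y, z} \<in> H" by simp
    then obtain a b g where g: "{y, z} = {a, b}" "arc g" "pathstart g = pos a" "pathfinish g = pos b"
      "path_image g = im {y, z}" using edge assms(1) by blast
    have "path_connected (im {y, z})"
      using g(2,5) path_connected_path_image arc_imp_path by metis
    then have "path_component (im {y, z}) (pos y) (pos z)"
      using endpoint_in_im[of "{y, z}"] yz assms(1) unfolding path_connected_component by blast
    then have "path_component (drawn H) (pos y) (pos z)"
      using yz by (auto simp: drawn_def intro: path_component_of_subset[rotated])
    then show ?case using step.IH path_component_trans by metis
  qed simp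
  then show ?thesis using assms(3) by blast
qed

text \<open>
  The drawing splits into the part \<open>H1\<close> reachable from \<open>p\<close> and the rest \<open>H2\<close>. The curve of \<open>e\<close> meets
  \<open>H1\<close> at most in \<open>p\<close> and \<open>H2\<close> at most in \<open>q\<close>, so Janiszewski's theorem applies twice.
\<close>
lemma bridge_does_not_separate:
  assumes "H \<subseteq> ES" "e \<in> ES" "e = {p, q}" "\<not> joined H p q"
    and xy: "connected_component (- drawn H) x y" "x \<notin> im e" "y \<notin> im e"
  shows "connected_component (- drawn (insert e H)) x y"
proof -
  define H1 where "H1 = {e' \<in> H. \<forall>r\<in>e'. joined H p r}"
  define H2 where "H2 = {e' \<in> H. \<forall>r\<in>e'. \<not> joined H p r}"
  have H12: "H = H1 \<union> H2"
  proof -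
    have "e' \<in> H1 \<union> H2" if e': "e' \<in> H" for e'
    proof -
      obtain a b where ab: "e' = {a, b}" using edge assms(1) e' by blast
      have "joined H p a \<longleftrightarrow> joined H p b"
      proof -
        have "(a, b) \<in> {(a, b). {a, b} \<in> H}" "(b, a) \<in> {(a, b). {a, b} \<in> H}"
          using ab e' by (auto simp: insert_commute)
        then show ?thesis unfolding joined_def by (blast intro: rtrancl.rtrancl_into_rtrancl)
      qed
      then show ?thesis using ab e' by (auto simp: H1_def H2_def)
    qed
    then show ?thesis by (auto simp: H1_def H2_def)
  qed
  have sub: "H1 \<subseteq> ES" "H2 \<subseteq> ES" "e \<notin> H1" "e \<notin> H2"
    using assms(1,3,4) by (auto simp: H1_def H2_def joined_def)
  obtain g where g: "arc g" "path_image g = im e" using edge[OF assms(2)] by blast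
  have small: "connected S" if "S \<subseteq> {a}" for S :: "complex set" and a
    using subset_singletonD[OF that] by (elim disjE) simp_all
  have "p \<notin> \<Union>H2" "q \<notin> \<Union>H1" using assms(4) by (auto simp: H1_def H2_def joined_def)
  then have e1: "im e \<inter> drawn H1 \<subseteq> {pos p}" and e2: "im e \<inter> drawn H2 \<subseteq> {pos q}"
    using im_Int_drawn[OF assms(2) sub(1,3)] im_Int_drawn[OF assms(2) sub(2,4)] assms(3) by auto
  have disj: "drawn H1 \<inter> drawn H2 = {}"
  proof -
    have "im a \<inter> im b = {}" if mem: "a \<in> H1" "b \<in> H2" for a b
    proof -
      have "a \<inter> b = {}" using mem by (auto simp: H1_def H2_def)
      moreover obtain r where "r \<in> a" using edge[of a] sub(1) mem(1) by blast
      ultimately have "a \<noteq> b" by blast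
      then show ?thesis using im_Int_im[of a b] mem sub \<open>a \<inter> b = {}\<close> by auto
    qed
    then show ?thesis by (auto simp: drawn_def)
  qed
  have "connected (- im e)" using connected_arc_complement[OF g(1)] g(2) by simp
  then have ce: "connected_component (- im e) x y"
    using xy(2,3) unfolding connected_iff_connected_component by blast
  have c1: "connected_component (- drawn H1) x y" and c2: "connected_component (- drawn H2) x y"
    by (rule connected_component_of_subset[OF xy(1)], auto simp: H1_def H2_def drawn_def)+
  have "connected_component (- (im e \<union> drawn H1)) x y"
    by (rule Janiszewski[OF compact_im[OF assms(2)] closed_drawn[OF sub(1)] small[OF e1] ce c1])
  moreover have "(im e \<union> drawn H1) \<inter> drawn H2 \<subseteq> {pos q}" using e2 disj by blast
  ultimately have "connected_component (- ((im e \<union> drawn H1) \<union> drawn H2)) x y"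
    using compact_im[OF assms(2)] compact_drawn[OF sub(1)] closed_drawn[OF sub(2)]
    by (intro Janiszewski[OF _ _ small _ c2] compact_Un)
  moreover have "(im e \<union> drawn H1) \<union> drawn H2 = drawn (insert e H)"
    using H12 by (auto simp: drawn_def)
  ultimately show ?thesis by simp
qed

text \<open>
  A path from \<open>p\<close> to \<open>q\<close> in the drawing of \<open>H\<close> closes the curve of \<open>e\<close> to a Jordan curve \<open>J\<close>. For the last
  claim, \<open>J\<close> meets the drawing of \<open>H\<close> exactly in that path, which is connected, so Janiszewski's
  theorem says that points on the same side of \<open>J\<close> and in the same face of \<open>H\<close> are
  not separated by the two sets together.
\<close>
lemma nonbridge_separates:
  assumes "H \<subseteq> ES" "e \<in> ES" "e \<notin> H" "e = {p, q}" "joined H p q"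
  obtains J A B where "im e \<subseteq> J" "J \<subseteq> drawn (insert e H)" "open A" "open B" "A \<inter> B = {}"
    "A \<union> B = - J" "frontier A = J" "frontier B = J"
    "\<forall>x y. connected_component (- drawn H) x y \<and> ((x \<in> A \<and> y \<in> A) \<or> (x \<in> B \<and> y \<in> B)) \<longrightarrow>
        connected_component (- drawn (insert e H)) x y"
proof -
  obtain p' q' c where c: "p' \<in> P" "q' \<in> P" "p' \<noteq> q'" "e = {p', q'}" "arc c" "pathstart c = pos p'"
    "pathfinish c = pos q'" "path_image c = im e" using edge[OF assms(2)] by blast
  have "joined H q' p'" using assms(4,5) c(4) joined_sym by (auto simp: doubleton_eq_iff)
  then have "path_component (drawn H) (pos q') (pos p')" using joined_path assms(1) c(3) by metis
  then obtain h where h: "path h" "path_image h \<subseteq> drawn H" "pathstart h = pos q'" "pathfinish h = pos p'"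
    by (auto simp: path_component_def)
  have "pos q' \<noteq> pos p'" using inj_onD[OF inj_pos _ c(2,1)] c(3) by blast
  then obtain g where g: "arc g" "path_image g \<subseteq> path_image h" "pathstart g = pos q'" "pathfinish g = pos p'"
    using path_contains_arc[OF h(1,3,4)] by blast
  have gH: "path_image g \<subseteq> drawn H" using g(2) h(2) by blast
  have ends: "im e \<inter> drawn H \<subseteq> {pos p', pos q'}"
    using im_Int_drawn[OF assms(2,1,3)] c(4) by auto
  define J where "J = path_image (c +++ g)"
  have J: "J = im e \<union> path_image g"
    using c g by (simp add: J_def path_image_join)
  have "simple_path (c +++ g)"
    by (rule simple_path_join_loop) (use c g gH ends in auto)
  moreover have "pathfinish (c +++ g) = pathstart (c +++ g)" using c g by simp
  ultimately obtain A B where AB: "open A" "connected A" "open B" "connected B"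
    "A \<inter> B = {}" "A \<union> B = - J" "frontier A = J" "frontier B = J"
    unfolding J_def by (rule Jordan_curve)
  have g_ends: "pos p' \<in> path_image g" "pos q' \<in> path_image g"
    using g(3,4) pathstart_in_path_image pathfinish_in_path_image by metis+
  have "J \<inter> drawn H = path_image g" using J gH ends g_ends by auto
  then have conn: "connected (J \<inter> drawn H)" using connected_arc_image[OF g(1)] by simp
  have cJ: "compact J" unfolding J using compact_im[OF assms(2)] compact_arc_image[OF g(1)] by (rule compact_Un)
  have Jd: "J \<union> drawn H = drawn (insert e H)" using J gH by (auto simp: drawn_insert)
  show ?thesis
  proof
    show "im e \<subseteq> J" "J \<subseteq> drawn (insert e H)" using J Jd by auto
    show "\<forall>x y. connected_component (- drawn H) x y \<and> ((x \<in> A \<and> y \<in> A) \<or> (x \<in> B \<and> y \<in> B)) \<longrightarrow>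
        connected_component (- drawn (insert e H)) x y"
    proof (intro allI impI)
      fix x y
      assume xy: "connected_component (- drawn H) x y \<and> ((x \<in> A \<and> y \<in> A) \<or> (x \<in> B \<and> y \<in> B))"
      have "connected_component (- J) x y"
        unfolding connected_component_def using xy AB(2,4,6) by blast
      then have "connected_component (- (J \<union> drawn H)) x y"
        using Janiszewski[OF cJ closed_drawn[OF assms(1)] conn] xy by blast
      then show "connected_component (- drawn (insert e H)) x y" by (simp add: Jd)
    qed
  qed (use AB in auto)
qed

end

section \<open>Counting faces\<close>
text \<open>
  An end of a longest path has a second neighbour, which lies on the path and closes a cycle.
\<close>
lemma cycle_of_min_degree_two:
  assumes fin: "finite H" and ne: "H \<noteq> {}"
    and two: "\<And>e. e \<in> H \<Longrightarrow> \<exists>a b. a \<noteq> b \<and> e = {a, b}"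
    and branch: "\<And>e p. e \<in> H \<Longrightarrow> p \<in> e \<Longrightarrow> \<exists>e'\<in>H. e' \<noteq> e \<and> p \<in> e'"
  obtains xs where "distinct xs" "3 \<le> length xs" "length xs \<le> card H"
    "\<forall>i. Suc i < length xs \<longrightarrow> {xs ! i, xs ! Suc i} \<in> H" "{hd xs, last xs} \<in> H"
proof -
  define path where "path xs \<longleftrightarrow> distinct xs \<and> set xs \<subseteq> \<Union>H \<and> 2 \<le> length xs \<and>
    (\<forall>i. Suc i < length xs \<longrightarrow> {xs ! i, xs ! Suc i} \<in> H)" for xs
  have finU: "finite (\<Union>H)"
  proof (rule finite_Union[OF fin])
    fix e assume "e \<in> H"
    then obtain a b where "e = {a, b}" using two by blast
    then show "finite e" by simp
  qed
  obtain e0 where "e0 \<in> H" using ne by blast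
  then obtain a0 b0 where "a0 \<noteq> b0" "{a0, b0} \<in> H" using two by metis
  then have p0: "path [a0, b0]" by (auto simp: path_def less_Suc_eq)
  have bound: "length xs \<le> card (\<Union>H)" if "path xs" for xs
    using that distinct_card[of xs] card_mono[OF finU, of "set xs"] by (simp add: path_def)
  have "\<exists>xs. path xs \<and> (\<forall>ys. path ys \<longrightarrow> length ys \<le> length xs)"
    using ex_has_greatest_nat[of path "[a0, b0]" length "Suc (card (\<Union>H))"] p0 bound
    by (simp add: less_Suc_eq_le)
  then obtain xs where xs: "path xs" and max: "\<And>ys. path ys \<Longrightarrow> length ys \<le> length xs"
    by blast
  have d: "distinct xs" and len: "2 \<le> length xs" and sub: "set xs \<subseteq> \<Union>H"
    and step: "\<And>i. Suc i < length xs \<Longrightarrow> {xs ! i, xs ! Suc i} \<in> H"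
    using xs by (auto simp: path_def)
  have e01: "{xs ! 0, xs ! 1} \<in> H" using step[of 0] len by simp
  obtain e where e: "e \<in> H" "e \<noteq> {xs ! 0, xs ! 1}" "xs ! 0 \<in> e" using branch[OF e01] by blast
  then obtain z where z: "e = {xs ! 0, z}" "z \<noteq> xs ! 0" using two[OF e(1)] by auto
  have "z \<in> set xs"
  proof (rule ccontr)
    assume nz: "z \<notin> set xs"
    have "path (z # xs)"
      unfolding path_def
    proof (intro conjI allI impI)
      fix i assume "Suc i < length (z # xs)"
      then show "{(z # xs) ! i, (z # xs) ! Suc i} \<in> H"
      proof (cases i)
        case 0
        have "{z, xs ! 0} \<in> H" using e(1) z(1) by (simp add: insert_commute)
        then show ?thesis using 0 by simp
      next
        case (Suc j)
        then show ?thesis using step[of j] \<open>Suc i < length (z # xs)\<close> by simp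
      qed
    next
      show "distinct (z # xs)" "2 \<le> length (z # xs)" using d nz len by simp_all
      have "z \<in> \<Union>H" using e(1) z(1) by blast
      then show "set (z # xs) \<subseteq> \<Union>H" using sub by simp
    qed
    then show False using max[of "z # xs"] by simp
  qed
  then obtain n where n: "n < length xs" "z = xs ! n" by (auto simp: in_set_conv_nth)
  have n2: "2 \<le> n"
  proof -
    have "n \<noteq> 0" "n \<noteq> 1" using z e(2) n(2) by metis+
    then show ?thesis by simp
  qed
  define ys where "ys = take (Suc n) xs"
  have ys: "distinct ys" "length ys = Suc n" "\<And>i. i \<le> n \<Longrightarrow> ys ! i = xs ! i"
    using d n by (auto simp: ys_def)
  have closing: "{ys ! 0, ys ! n} \<in> H" using e(1) z(1) n(2) ys(3)[of 0] ys(3)[of n] by simp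
  have hdlast: "hd ys = ys ! 0" "last ys = ys ! n"
  proof -
    have "ys \<noteq> []" using ys(2) by auto
    then show "hd ys = ys ! 0" "last ys = ys ! n" using ys(2) by (simp_all add: hd_conv_nth last_conv_nth)
  qed
  have ystep: "{ys ! i, ys ! Suc i} \<in> H" if "Suc i < length ys" for i
    using step[of i] that ys(2) ys(3)[of i] ys(3)[of "Suc i"] n(1) by simp
  define f where "f i = (if i < n then {ys ! i, ys ! Suc i} else {ys ! 0, ys ! n})" for i
  have eq: "ys ! i = ys ! j \<longleftrightarrow> i = j" if "i \<le> n" "j \<le> n" for i j
    using nth_eq_iff_index_eq[OF ys(1)] that ys(2) by simp
  have f_neq: "f i \<noteq> f j" if ij: "i < j" "j \<le> n" for i j
  proof (cases "j < n")
    case True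
    then have "f i = {ys ! i, ys ! Suc i}" "f j = {ys ! j, ys ! Suc j}" using ij by (simp_all add: f_def)
    moreover have "ys ! i \<noteq> ys ! j" "ys ! i \<noteq> ys ! Suc j"
      using eq[of i j] eq[of i "Suc j"] ij True by simp_all
    ultimately show ?thesis by auto
  next
    case False
    then have "f i = {ys ! i, ys ! Suc i}" "f j = {ys ! 0, ys ! n}" using ij by (simp_all add: f_def)
    moreover have "ys ! n \<noteq> ys ! i" "ys ! 0 = ys ! i \<longrightarrow> ys ! n \<noteq> ys ! Suc i"
      using eq[of n i] eq[of 0 i] eq[of n "Suc i"] ij n2 by auto
    ultimately show ?thesis by (auto simp: doubleton_eq_iff)
  qed
  have "inj_on f {..n}"
  proof (rule inj_onI)
    fix i j assume ij: "i \<in> {..n}" "j \<in> {..n}" "f i = f j"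
    consider "i < j" | "i = j" | "j < i" by linarith
    then show "i = j" using ij f_neq[of i j] f_neq[of j i] by cases simp_all
  qed
  moreover have "f ` {..n} \<subseteq> H"
  proof (rule image_subsetI)
    fix i assume "i \<in> {..n}"
    then show "f i \<in> H" using ystep[of i] closing ys(2) by (simp add: f_def)
  qed
  ultimately have "card {..n} \<le> card H" using card_inj_on_le fin by blast
  then have "length ys \<le> card H" using ys(2) by simp
  moreover have "3 \<le> length ys" using n2 ys(2) by simp
  moreover have "{hd ys, last ys} \<in> H" using closing hdlast by simp
  ultimately show ?thesis using that[OF ys(1)] ystep by blast
qed

context plane_graph
begin

lemma open_face: "H \<subseteq> ES \<Longrightarrow> C \<in> faces H \<Longrightarrow> open C"
  unfolding faces_def using open_components closed_drawn open_Compl by metis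

lemma face_facts:
  assumes "C \<in> faces H"
  shows "C \<noteq> {}" "connected C" "C \<inter> drawn H = {}"
  using assms in_components_nonempty in_components_connected in_components_subset
  unfolding faces_def by blast+

lemma faces_disjoint: "C \<in> faces H \<Longrightarrow> C' \<in> faces H \<Longrightarrow> C \<inter> C' \<noteq> {} \<Longrightarrow> C = C'"
  unfolding faces_def using components_eq by blast

lemma faces_maximal: "C \<in> faces H \<Longrightarrow> connected T \<Longrightarrow> T \<inter> drawn H = {} \<Longrightarrow> C \<inter> T \<noteq> {} \<Longrightarrow> T \<subseteq> C"
  unfolding faces_def using components_maximal[of C "- drawn H" T] by blast

lemma face_exists: "x \<notin> drawn H \<Longrightarrow> \<exists>C\<in>faces H. x \<in> C"
  unfolding faces_def by (metis ComplI Union_components UnionE)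

lemma same_face:
  assumes "C \<in> faces H" "C' \<in> faces H" "x \<in> C" "y \<in> C'" "connected_component (- drawn H) x y"
  shows "C = C'"
proof -
  obtain T where T: "connected T" "T \<subseteq> - drawn H" "x \<in> T" "y \<in> T"
    using assms(5) by (auto simp: connected_component_def)
  then have "T \<subseteq> C" "T \<subseteq> C'"
    using faces_maximal[OF assms(1) T(1)] faces_maximal[OF assms(2) T(1)] assms(3,4) by blast+
  then show ?thesis using faces_disjoint assms(1,2) T(3) by blast
qed

lemma same_face_conn: "C \<in> faces H \<Longrightarrow> x \<in> C \<Longrightarrow> y \<in> C \<Longrightarrow> connected_component (- drawn H) x y"
  unfolding connected_component_def using face_facts by blast

lemma drawn_mono: "H \<subseteq> H' \<Longrightarrow> drawn H \<subseteq> drawn H'"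
  by (auto simp: drawn_def)

lemma face_superset:
  assumes "H \<subseteq> H'" "f \<in> faces H'"
  shows "\<exists>C\<in>faces H. f \<subseteq> C"
proof -
  obtain x where x: "x \<in> f" using face_facts[OF assms(2)] by blast
  have nf: "f \<inter> drawn H = {}" using face_facts(3)[OF assms(2)] drawn_mono[OF assms(1)] by blast
  then obtain C where C: "C \<in> faces H" "x \<in> C" using face_exists x by blast
  then show ?thesis using faces_maximal[OF C(1) face_facts(2)[OF assms(2)] nf] x by blast
qed

text \<open>
  The parts of \<open>C\<close> are distinguished by the side of the Jordan curve through \<open>e\<close> on which they lie, if \<open>e\<close>
  lies on a cycle; a bridge does not separate points of \<open>C\<close> at all.
\<close>
lemma edge_splits_face_le2:
  assumes "H \<subseteq> ES" "e \<in> ES" "e \<notin> H" "C \<in> faces H"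
  shows "finite {f \<in> faces (insert e H). f \<subseteq> C}" "card {f \<in> faces (insert e H). f \<subseteq> C} \<le> 2"
proof -
  let ?F = "{f \<in> faces (insert e H). f \<subseteq> C}"
  obtain p q where pq: "e = {p, q}" using edge assms(2) by blast
  have "\<exists>S. inj_on (\<lambda>f. f \<subseteq> S) ?F"
  proof (cases "joined H p q")
    case True
    obtain J A B where J: "im e \<subseteq> J" "J \<subseteq> drawn (insert e H)" "open A" "open B" "A \<inter> B = {}"
    "A \<union> B = - J" "frontier A = J" "frontier B = J"
    "\<forall>x y. connected_component (- drawn H) x y \<and> ((x \<in> A \<and> y \<in> A) \<or> (x \<in> B \<and> y \<in> B)) \<longrightarrow>
        connected_component (- drawn (insert e H)) x y"
      using nonbridge_separates[OF assms(1-3) pq True] .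
    note conn = J(9)
    have side: "f \<subseteq> A \<or> f \<subseteq> B" if f: "f \<in> ?F" for f
    proof -
      have "connected f" "f \<subseteq> A \<union> B" using f face_facts[of f "insert e H"] J by blast+
      then show ?thesis using connectedD[of f A B] J(3-5) by blast
    qed
    have "inj_on (\<lambda>f. f \<subseteq> A) ?F"
    proof (rule inj_onI)
      fix f g assume f: "f \<in> ?F" and g: "g \<in> ?F" and eq: "(f \<subseteq> A) = (g \<subseteq> A)"
      obtain x y where x: "x \<in> f" and y: "y \<in> g" using f g face_facts(1)[of _ "insert e H"] by blast
      have xyC: "x \<in> C" "y \<in> C" using x y f g by blast+
      have "(x \<in> A \<and> y \<in> A) \<or> (x \<in> B \<and> y \<in> B)" using side[OF f] side[OF g] x y eq by blast
      then have "connected_component (- drawn (insert e H)) x y"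
        using conn same_face_conn[OF assms(4) xyC] by blast
      then show "f = g" using same_face x y f g by blast
    qed
    then show ?thesis by blast
  next
    case False
    have "f = g" if f: "f \<in> ?F" and g: "g \<in> ?F" for f g
    proof -
      obtain x y where x: "x \<in> f" and y: "y \<in> g" using f g face_facts(1)[of _ "insert e H"] by blast
      have xyC: "x \<in> C" "y \<in> C" using x y f g by blast+
      have "x \<notin> im e" "y \<notin> im e"
        using x y f g face_facts(3)[of _ "insert e H"] by (auto simp: drawn_insert)
      then have "connected_component (- drawn (insert e H)) x y"
        using bridge_does_not_separate[OF assms(1,2) pq False] same_face_conn[OF assms(4) xyC] by blast
      then show "f = g" using same_face x y f g by blast
    qed
    then show ?thesis by (auto simp: inj_on_def)
  qed
  then show "finite ?F" "card ?F \<le> 2" using card_le_2_bool by blast+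
qed

definition parent_face :: "'v set set \<Rightarrow> complex set \<Rightarrow> complex set" where
  "parent_face H f = (SOME C. C \<in> faces H \<and> f \<subseteq> C)"

lemma parent_face:
  assumes "f \<in> faces (insert e H)"
  shows "parent_face H f \<in> faces H" "f \<subseteq> parent_face H f"
    and "C \<in> faces H \<Longrightarrow> f \<subseteq> C \<Longrightarrow> parent_face H f = C"
proof -
  have ex: "\<exists>C. C \<in> faces H \<and> f \<subseteq> C" using face_superset[OF _ assms] by blast
  show 1: "parent_face H f \<in> faces H" "f \<subseteq> parent_face H f"
    unfolding parent_face_def using someI_ex[OF ex] by blast+
  show "C \<in> faces H \<Longrightarrow> f \<subseteq> C \<Longrightarrow> parent_face H f = C"
    using faces_disjoint[OF 1(1)] 1(2) face_facts(1)[OF assms] by blast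
qed

lemma finite_faces_insert:
  assumes "H \<subseteq> ES" "e \<in> ES" "e \<notin> H" "finite (faces H)"
  shows "finite (faces (insert e H))"
proof -
  have "faces (insert e H) \<subseteq> (\<Union>C\<in>faces H. {f \<in> faces (insert e H). f \<subseteq> C})"
  proof
    fix f assume f: "f \<in> faces (insert e H)"
    then show "f \<in> (\<Union>C\<in>faces H. {f \<in> faces (insert e H). f \<subseteq> C})"
      using parent_face(1,2)[OF f] by blast
  qed
  moreover have "finite (\<Union>C\<in>faces H. {f \<in> faces (insert e H). f \<subseteq> C})"
    using assms(4) edge_splits_face_le2(1)[OF assms(1-3)] by (rule finite_UN_I)
  ultimately show ?thesis by (rule finite_subset)
qed

lemma parent_face_surj:
  assumes "H \<subseteq> ES" "e \<in> ES" "e \<notin> H" "finite (faces H)"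
  shows "faces H = parent_face H ` faces (insert e H)"
proof
  show "parent_face H ` faces (insert e H) \<subseteq> faces H" by (rule image_subsetI) (rule parent_face(1))
  show "faces H \<subseteq> parent_face H ` faces (insert e H)"
  proof
    fix C assume C: "C \<in> faces H"
    obtain g where g: "arc g" "path_image g = im e" using edge[OF assms(2)] by blast
    have "\<not> C \<subseteq> im e"
      using arc_image_open_subset_empty[OF g(1) open_face[OF assms(1) C]] g(2) face_facts(1)[OF C] by blast
    then obtain x where x: "x \<in> C" "x \<notin> im e" by blast
    then have "x \<notin> drawn (insert e H)" using face_facts(3)[OF C] by (auto simp: drawn_insert)
    then obtain f where f: "f \<in> faces (insert e H)" "x \<in> f" using face_exists[of x "insert e H"] by blast
    then have "parent_face H f = C"
      using faces_disjoint[OF parent_face(1)[OF f(1)] C] parent_face(2)[OF f(1)] x(1) by blast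
    then show "C \<in> parent_face H ` faces (insert e H)" using f by blast
  qed
qed

text \<open>
  Near an inner point of \<open>e\<close> there are points on both sides of a Jordan curve through \<open>e\<close>, and these
  lie in the same face of \<open>H\<close>.
\<close>
lemma nonbridge_new_face:
  assumes "H \<subseteq> ES" "e \<in> ES" "e \<notin> H" "finite (faces H)" "e = {p, q}" "joined H p q"
  shows "card (faces H) < card (faces (insert e H))"
proof -
  have fin: "finite (faces (insert e H))" using finite_faces_insert assms by blast
  obtain J A B where J: "im e \<subseteq> J" "J \<subseteq> drawn (insert e H)" "open A" "open B" "A \<inter> B = {}"
    "A \<union> B = - J" "frontier A = J" "frontier B = J"
    "\<forall>x y. connected_component (- drawn H) x y \<and> ((x \<in> A \<and> y \<in> A) \<or> (x \<in> B \<and> y \<in> B)) \<longrightarrow>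
        connected_component (- drawn (insert e H)) x y"
    using nonbridge_separates[OF assms(1-3,5,6)] .
  obtain p' q' g where g: "p' \<in> P" "q' \<in> P" "e = {p', q'}" "arc g" "path_image g = im e" "p' \<noteq> q'"
    "pathstart g = pos p'" "pathfinish g = pos q'"
    using edge[OF assms(2)] by blast
  have "im e - pos ` e \<noteq> {}"
    using nonempty_simple_path_endless[OF arc_imp_simple_path[OF g(4)]] g(3,5,7,8) by simp
  then obtain m where m: "m \<in> im e" "m \<notin> pos ` e" by blast
  then have "m \<notin> drawn H" using im_Int_drawn[OF assms(2,1,3)] by blast
  then obtain C where C: "C \<in> faces H" "m \<in> C" using face_exists by blast
  have oC: "open C" by (rule open_face[OF assms(1) C(1)])
  have "m \<in> closure A" "m \<in> closure B" using m(1) J(1,7,8) by (auto simp: frontier_def)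
  then have "C \<inter> A \<noteq> {}" "C \<inter> B \<noteq> {}" using open_Int_closure_eq_empty[OF oC] C(2) by blast+
  then obtain a b where ab: "a \<in> C" "a \<in> A" "b \<in> C" "b \<in> B" by blast
  have "a \<notin> drawn (insert e H)" "b \<notin> drawn (insert e H)"
    using ab face_facts(3)[OF C(1)] J(1,6) by (auto simp: drawn_insert)
  then obtain fa fb where f: "fa \<in> faces (insert e H)" "a \<in> fa" "fb \<in> faces (insert e H)" "b \<in> fb"
    using face_exists[of a "insert e H"] face_exists[of b "insert e H"] by blast
  have "fa \<noteq> fb"
  proof
    assume "fa = fb"
    then have "connected fa" "fa \<subseteq> A \<union> B" "a \<in> fa" "b \<in> fa"
      using f face_facts[OF f(1)] J(2,6) by blast+
    then show False using connectedD[of fa A B] J(3-5) ab by blast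
  qed
  moreover have "parent_face H fa = C" "parent_face H fb = C"
    using faces_disjoint[OF parent_face(1)[OF f(1)] C(1)] faces_disjoint[OF parent_face(1)[OF f(3)] C(1)]
      parent_face(2)[OF f(1)] parent_face(2)[OF f(3)] f ab by blast+
  ultimately have "\<not> inj_on (parent_face H) (faces (insert e H))" using f(1,3) unfolding inj_on_def by metis
  then have "card (parent_face H ` faces (insert e H)) < card (faces (insert e H))"
    using eq_card_imp_inj_on[OF fin, of "parent_face H"] card_image_le[OF fin, of "parent_face H"]
    by linarith
  then show ?thesis using parent_face_surj[OF assms(1-4)] by simp
qed

definition joined_class :: "'v set set \<Rightarrow> 'v \<Rightarrow> 'v set" where
  "joined_class H p = {q \<in> P. joined H p q}"

lemma joined_class_eq_iff:
  assumes "p \<in> P" "q \<in> P"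
  shows "joined_class H p = joined_class H q \<longleftrightarrow> joined H p q"
proof
  assume "joined_class H p = joined_class H q"
  moreover have "q \<in> joined_class H q" using assms by (simp add: joined_class_def joined_def)
  ultimately show "joined H p q" by (auto simp: joined_class_def)
next
  assume "joined H p q"
  moreover from this have "joined H q p" by (rule joined_sym)
  ultimately show "joined_class H p = joined_class H q" unfolding joined_class_def joined_def by (blast intro: rtrancl_trans)
qed

lemma joined_mono: "joined H p q \<Longrightarrow> joined (insert e H) p q"
  unfolding joined_def by (erule rtrancl_mono[THEN subsetD, rotated]) auto

text \<open>
  This half of Euler's formula is all that an upper bound on the number of edges needs. Adding an
  edge either creates a face or joins two components of the graph.
\<close>
theorem euler_inequality:
  assumes "H \<subseteq> ES"
  shows "finite (faces H) \<and> card H + 1 + card (joined_class H ` P) \<le> card (faces H) + card P"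
  using finite_subset[OF assms finES] assms
proof (induction H rule: finite_induct)
  case empty
  have "faces {} = {UNIV}" by (simp add: faces_def drawn_def)
  moreover have "card (joined_class {} ` P) \<le> card P" by (rule card_image_le[OF finP])
  ultimately show ?case by simp
next
  case (insert e H)
  then have H: "H \<subseteq> ES" "e \<in> ES" "e \<notin> H" by auto
  note IH = insert.IH[OF H(1)]
  then have fin: "finite (faces H)" by blast
  have fin': "finite (faces (insert e H))" using finite_faces_insert[OF H fin] .
  have ch: "card (insert e H) = card H + 1" using insert.hyps by simp
  obtain p q where pq: "e = {p, q}" "p \<in> P" "q \<in> P" using edge[OF H(2)] by blast
  have coarse: "joined_class (insert e H) x = joined_class (insert e H) y" if "x \<in> P" "y \<in> P" "joined_class H x = joined_class H y" for x y
    using that joined_class_eq_iff[of x y H] joined_class_eq_iff[of x y "insert e H"] joined_mono[of H x y e] by blast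
  show ?case
  proof (cases "joined H p q")
    case True
    have "card (joined_class (insert e H) ` P) \<le> card (joined_class H ` P)"
      by (rule card_image_coarser(1)[OF finP coarse])
    then show ?thesis using nonbridge_new_face[OF H fin pq(1) True] IH ch fin' by linarith
  next
    case False
    have "joined (insert e H) p q" unfolding joined_def using pq(1) by auto
    then have "card (joined_class (insert e H) ` P) < card (joined_class H ` P)"
      using joined_class_eq_iff[OF pq(2,3)] False by (intro card_image_coarser(2)[OF finP coarse pq(2,3)]) simp_all
    moreover have "card (faces H) \<le> card (faces (insert e H))"
      using parent_face_surj[OF H fin] card_image_le[OF fin'] by metis
    ultimately show ?thesis using IH ch fin' by linarith
  qed
qed

text \<open>
  The edge \<open>e\<close> is taken to border \<open>f\<close> if \<open>f\<close> is no longer a face after the removal of \<open>e\<close>. This avoids any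
  local analysis of arcs: all such faces lie in the one face of the smaller drawing that contains
  the inner points of \<open>e\<close>, and \<open>e\<close> splits it into at most two.
\<close>
lemma edge_on_at_most_two_faces:
  assumes "e \<in> ES"
  shows "card {f \<in> faces ES. f \<notin> faces (ES - {e})} \<le> 2"
proof -
  let ?H = "ES - {e}"
  have H: "?H \<subseteq> ES" "e \<notin> ?H" "insert e ?H = ES" using assms by auto
  obtain p q g where g: "e = {p, q}" "arc g" "pathstart g = pos p" "pathfinish g = pos q" "path_image g = im e"
    using edge[OF assms] by blast
  have "im e \<inter> drawn ?H \<subseteq> {pos p, pos q}" using im_Int_drawn[OF assms H(1,2)] g(1) by auto
  then have conn: "connected (im e - drawn ?H)"
    using connected_arc_minus_endpoints[OF g(2), of "drawn ?H"] g by simp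
  have meets: "C \<inter> (im e - drawn ?H) \<noteq> {}"
    if f: "f \<in> faces ES" "f \<notin> faces ?H" and C: "C \<in> faces ?H" "f \<subseteq> C" for f C
  proof
    assume "C \<inter> (im e - drawn ?H) = {}"
    then have "C \<inter> drawn ES = {}"
      using face_facts(3)[OF C(1)] drawn_insert[of e ?H] H(3) by auto
    then have "C \<subseteq> f" using faces_maximal[OF f(1) face_facts(2)[OF C(1)]] face_facts(1)[OF f(1)] C(2) by blast
    then show False using f(2) C by auto
  qed
  show ?thesis
  proof (cases "{f \<in> faces ES. f \<notin> faces ?H} = {}")
    case False
    then obtain f0 where f0: "f0 \<in> faces ES" "f0 \<notin> faces ?H" by blast
    obtain C where C: "C \<in> faces ?H" "f0 \<subseteq> C" using face_superset[OF H(1) f0(1)] by blast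
    have "{f \<in> faces ES. f \<notin> faces ?H} \<subseteq> {f \<in> faces (insert e ?H). f \<subseteq> C}"
    proof
      fix f assume f: "f \<in> {f \<in> faces ES. f \<notin> faces ?H}"
      then obtain C' where C': "C' \<in> faces ?H" "f \<subseteq> C'" using face_superset[OF H(1)] by blast
      have "im e - drawn ?H \<subseteq> C" "im e - drawn ?H \<subseteq> C'"
        using faces_maximal[OF C(1) conn] faces_maximal[OF C'(1) conn] meets[OF f0 C] meets[OF _ _ C'] f by blast+
      then have "C = C'" using faces_disjoint[OF C(1) C'(1)] meets[OF f0 C] by blast
      then show "f \<in> {f \<in> faces (insert e ?H). f \<subseteq> C}" using f C' H(3) by simp
    qed
    then have "card {f \<in> faces ES. f \<notin> faces ?H} \<le> card {f \<in> faces (insert e ?H). f \<subseteq> C}"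
      using edge_splits_face_le2(1)[OF H(1) assms H(2) C(1)] by (rule card_mono[rotated])
    then show ?thesis using edge_splits_face_le2(2)[OF H(1) assms H(2) C(1)] by linarith
  next
    case True
    then show ?thesis by (simp only: card.empty)
  qed
qed

text \<open>
  If every cycle has at least \<open>n\<close> edges, fewer than \<open>n\<close> edges form a forest. Removing a leaf edge, which meets
  the other edges in at most one point, does not change connectedness of the complement.
\<close>
lemma few_edges_do_not_separate:
  assumes girth: "\<And>xs. distinct xs \<Longrightarrow> 3 \<le> length xs \<Longrightarrow>
      (\<And>i. Suc i < length xs \<Longrightarrow> {xs ! i, xs ! Suc i} \<in> ES) \<Longrightarrow> {hd xs, last xs} \<in> ES \<Longrightarrow> n \<le> length xs"
    and "H \<subseteq> ES" "card H < n"
  shows "connected (- drawn H)"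
  using finite_subset[OF assms(2) finES] assms(2,3)
proof (induction "card H" arbitrary: H rule: less_induct)
  case less
  note finH = less.prems(1) and H = less.prems(2) and small = less.prems(3)
  show ?case
  proof (cases "H = {}")
    case True
    then show ?thesis by (simp add: drawn_def connected_UNIV)
  next
    case False
    have "\<exists>e p. e \<in> H \<and> p \<in> e \<and> (\<forall>e'\<in>H. p \<in> e' \<longrightarrow> e' = e)"
    proof (rule ccontr)
      assume no_leaf: "\<not> ?thesis"
      have two: "\<exists>a b. a \<noteq> b \<and> e = {a, b}" if "e \<in> H" for e
      proof -
        have "e \<in> ES" using that H by blast
        then obtain a b where "a \<noteq> b" "e = {a, b}" using edge[of e] by (elim meta_impE) auto
        then show ?thesis by blast
      qed
      have branch: "\<exists>e'\<in>H. e' \<noteq> e \<and> p \<in> e'" if "e \<in> H" "p \<in> e" for e p using no_leaf that by metis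
      obtain xs where xs: "distinct xs" "3 \<le> length xs" "length xs \<le> card H"
        "\<forall>i. Suc i < length xs \<longrightarrow> {xs ! i, xs ! Suc i} \<in> H" "{hd xs, last xs} \<in> H"
        using cycle_of_min_degree_two[OF finH False two branch] .
      have "n \<le> length xs"
        by (rule girth[OF xs(1,2)]) (use xs(4,5) H in blast)+
      then show False using xs(3) small by linarith
    qed
    then obtain e p where e: "e \<in> H" "p \<in> e" and leaf: "\<And>e'. e' \<in> H \<Longrightarrow> p \<in> e' \<Longrightarrow> e' = e" by blast
    let ?H = "H - {e}"
    have eES: "e \<in> ES" "?H \<subseteq> ES" using e H by blast+
    have ce: "card ?H < card H" by (rule card_Diff1_less[OF finH e(1)])
    have cH: "connected (- drawn ?H)"
      by (rule less.hyps[OF ce]) (use finH eES ce small in auto)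
    obtain a b g where g: "e = {a, b}" "arc g" "path_image g = im e" using edge[OF eES(1)] by blast
    have "p \<notin> \<Union>?H" using leaf by blast
    moreover obtain q where "e = {p, q}" using g(1) e(2) by auto
    ultimately have "e \<inter> \<Union>?H \<subseteq> {q}" by auto
    then have "pos ` (e \<inter> \<Union>?H) \<subseteq> {pos q}" by (metis image_mono image_insert image_empty)
    moreover have "im e \<inter> drawn ?H \<subseteq> pos ` (e \<inter> \<Union>?H)" by (rule im_Int_drawn[OF eES]) simp
    ultimately have "im e \<inter> drawn ?H \<subseteq> {pos q}" by simp
    then have "connected (im e \<inter> drawn ?H)" by (elim subset_singletonD[elim_format] disjE) simp_all
    moreover have "connected (- im e)" using connected_arc_complement[OF g(2)] g(3) by simp
    ultimately have "connected (- (im e \<union> drawn ?H))"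
      using Janiszewski_connected[OF compact_im[OF eES(1)] closed_drawn[OF eES(2)]] cH by blast
    moreover have "im e \<union> drawn ?H = drawn H" using e(1) by (auto simp: drawn_def)
    ultimately show ?thesis by simp
  qed
qed

text \<open>
  A frontier point off the bordering edges lies on some edge whose removal leaves \<open>f\<close> a face. The frontier
  is then contained in the other edges too, so the point lies on two edges and is a vertex.
\<close>
lemma frontier_face_subset:
  assumes "f \<in> faces ES"
  shows "frontier f \<subseteq> drawn {e \<in> ES. f \<notin> faces (ES - {e})} \<union> pos ` P"
proof
  fix x assume x: "x \<in> frontier f"
  have front: "frontier f \<subseteq> drawn H" if "f \<in> faces H" "H \<subseteq> ES" for H
    using frontier_of_components_closed_complement[OF closed_drawn[OF that(2)]] that(1)
    by (simp add: faces_def)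
  obtain e where e: "e \<in> ES" "x \<in> im e" using front[OF assms] x by (auto simp: drawn_def)
  show "x \<in> drawn {e \<in> ES. f \<notin> faces (ES - {e})} \<union> pos ` P"
  proof (cases "f \<in> faces (ES - {e})")
    case True
    then have "x \<in> drawn (ES - {e})" using front[OF True] x by blast
    then obtain e' where "e' \<in> ES" "e' \<noteq> e" "x \<in> im e'" by (auto simp: drawn_def)
    then show ?thesis using crossing[OF e(1)] e(2) by blast
  next
    case False
    then show ?thesis using e by (auto simp: drawn_def)
  qed
qed

text \<open>
  If fewer than \<open>n\<close> edges border some face, they do not separate the plane, so that face is the only one
  and Euler's inequality leaves fewer edges than vertices. Otherwise incidences between faces
  and bordering edges are counted twice.
\<close>
theorem plane_graph_edge_bound:
  assumes girth: "\<And>xs. distinct xs \<Longrightarrow> 3 \<le> length xs \<Longrightarrow>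
      (\<And>i. Suc i < length xs \<Longrightarrow> {xs ! i, xs ! Suc i} \<in> ES) \<Longrightarrow> {hd xs, last xs} \<in> ES \<Longrightarrow> n \<le> length xs"
    and "P \<noteq> {}"
  shows "card ES < card P \<or> n * (card ES + 2) \<le> n * card P + 2 * card ES"
proof -
  define B where "B f = {e \<in> ES. f \<notin> faces (ES - {e})}" for f
  have fin: "finite (faces ES)" and euler: "card ES + 1 + card (joined_class ES ` P) \<le> card (faces ES) + card P"
    using euler_inequality[of ES] by auto
  have "card (joined_class ES ` P) \<noteq> 0" using assms(2) finP by simp
  then have ge: "card ES + 2 \<le> card (faces ES) + card P" using euler by linarith
  show ?thesis
  proof (cases "\<exists>f\<in>faces ES. card (B f) < n")
    case True
    then obtain f where f: "f \<in> faces ES" "card (B f) < n" by blast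
    have BES: "B f \<subseteq> ES" by (auto simp: B_def)
    have "connected (- drawn (B f))"
      by (rule few_edges_do_not_separate[OF girth BES f(2)]) blast+
    moreover have "open (- drawn (B f))" using closed_drawn[OF BES] by (rule open_Compl)
    \<comment> \<open>The frontier of \<open>f\<close> may contain vertices off the edges in \<open>B f\<close>; removing these finitely
      many points keeps the complement connected.\<close>
    ultimately have conn: "connected (- drawn (B f) - pos ` P)"
      using finP by (intro connected_open_delete_finite) auto
    have not_fin: "\<not> U \<subseteq> pos ` P" if "open U" "U \<noteq> {}" for U
      using that finP finite_imp_not_open[of U] finite_subset by (metis finite_imageI)
    have "f \<inter> drawn (B f) = {}" using face_facts(3)[OF f(1)] drawn_mono[OF BES] by blast
    moreover have "\<not> f \<subseteq> pos ` P" using not_fin open_face[OF order_refl f(1)] face_facts(1)[OF f(1)] by blast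
    ultimately have "(- drawn (B f) - pos ` P) \<inter> f \<noteq> {}" by blast
    moreover have "(- drawn (B f) - pos ` P) \<inter> frontier f = {}"
      using frontier_face_subset[OF f(1)] by (auto simp: B_def)
    ultimately have sub: "- drawn (B f) - pos ` P \<subseteq> f"
      using connected_Int_frontier[OF conn] by blast
    have "f' = f" if f': "f' \<in> faces ES" for f'
    proof -
      have "\<not> f' \<subseteq> pos ` P" using not_fin open_face[OF order_refl f'] face_facts(1)[OF f'] by blast
      moreover have "f' \<inter> drawn (B f) = {}" using face_facts(3)[OF f'] drawn_mono[OF BES] by blast
      ultimately have "f' \<inter> f \<noteq> {}" using sub by blast
      then show ?thesis using faces_disjoint f' f(1) by blast
    qed
    then have "faces ES \<subseteq> {f}" by blast
    then have "card (faces ES) \<le> 1" using card_mono[of "{f}" "faces ES"] by simp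
    then show ?thesis using ge by linarith
  next
    case False
    then have "(\<Sum>f\<in>faces ES. n) \<le> (\<Sum>f\<in>faces ES. card (B f))"
      by (intro sum_mono) (auto simp: not_less)
    also have "\<dots> = (\<Sum>f\<in>faces ES. \<Sum>e\<in>{e \<in> ES. f \<notin> faces (ES - {e})}. 1)"
      by (simp add: B_def)
    also have "\<dots> = (\<Sum>e\<in>ES. \<Sum>f\<in>{f \<in> faces ES. f \<notin> faces (ES - {e})}. 1)"
      by (rule sum.swap_restrict[OF fin finES])
    also have "\<dots> = (\<Sum>e\<in>ES. card {f \<in> faces ES. f \<notin> faces (ES - {e})})" by simp
    also have "\<dots> \<le> (\<Sum>e\<in>ES. 2)" by (intro sum_mono edge_on_at_most_two_faces)
    finally have "n * card (faces ES) \<le> 2 * card ES" by (simp add: mult.commute)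
    moreover have "n * (card ES + 2) \<le> n * (card (faces ES) + card P)" using ge by (rule mult_le_mono2)
    ultimately show ?thesis by (simp add: distrib_left)
  qed
qed

end

section \<open>From digraphs to plane graphs\<close>
definition adj :: "('a, 'b) pre_digraph \<Rightarrow> 'a \<Rightarrow> 'a \<Rightarrow> bool" where
  "adj G x y \<longleftrightarrow> (\<exists>a\<in>arcs G. tail G a = x \<and> head G a = y)"

definition edges_in :: "('a, 'b) pre_digraph \<Rightarrow> 'a set \<Rightarrow> 'a set set" where
  "edges_in G W = {{x, y} |x y. x \<in> W \<and> y \<in> W \<and> adj G x y}"

text \<open>
  Opposite arcs of one edge share their image, so any choice serves.
\<close>
definition curve_of :: "('a, 'b) pre_digraph \<Rightarrow> ('b \<Rightarrow> real \<Rightarrow> complex) \<Rightarrow> 'a set \<Rightarrow> complex set" where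
  "curve_of G c e = path_image (c (SOME a. a \<in> arcs G \<and> {tail G a, head G a} = e))"

context Digraph.graph
begin

lemma adj_symp: "symp (adj G)"
proof (rule sympI)
  fix x y assume "adj G x y"
  then have "x \<rightarrow>\<^bsub>G\<^esub> y" by (auto simp: adj_def arcs_ends_def arc_to_ends_def)
  then have "y \<rightarrow>\<^bsub>G\<^esub> x" using sym_arcs by (auto simp: symmetric_def dest: symD)
  then show "adj G y x" by (auto simp: adj_def arcs_ends_def arc_to_ends_def)
qed

lemma adj_irrefl: "\<not> adj G x x"
  using no_loops unfolding adj_def by metis

lemma card_neighbours_le: "v \<in> verts G \<Longrightarrow> card (nbhd (adj G) (verts G) v) \<le> max_degree G"
proof -
  assume v: "v \<in> verts G"
  have "nbhd (adj G) (verts G) v \<subseteq> head G ` out_arcs G v"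
    by (auto simp: nbhd_def adj_def)
  then have "card (nbhd (adj G) (verts G) v) \<le> out_degree G v"
    unfolding out_degree_def by (meson surj_card_le finite_out_arcs)
  also have "\<dots> \<le> max_degree G"
    unfolding max_degree_def using v by (intro Max_ge) auto
  finally show ?thesis .
qed

lemma near_if_dist_le_2:
  assumes "x \<in> verts G" "y \<in> verts G" "x \<noteq> y" "graph_dist G x y \<le> 2"
  shows "y \<in> near (adj G) (verts G) x"
proof -
  have "(INF p\<in>{p. awalk x p y}. ereal (awalk_cost (\<lambda>_. 1) p)) < 3"
    using assms(4) unfolding graph_dist_def \<mu>_def by (rule order_le_less_trans) simp
  then obtain p where p: "awalk x p y" "ereal (awalk_cost (\<lambda>_. 1) p) < 3"
    by (auto simp: INF_less_iff)
  have "awalk_cost (\<lambda>_. 1) p = real (length p)"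
    by (simp add: awalk_cost_def sum_list_triv)
  then have "real (length p) < 3" using p(2) by (metis ereal_less(2) less_ereal.simps(1) numeral_eq_ereal)
  then have "length p \<le> 2" by simp
  then consider "p = []" | a where "p = [a]" | a b where "p = [a, b]"
    by (cases p; cases "tl p") (auto simp: Suc_le_eq)
  then show ?thesis
  proof cases
    case 1
    then show ?thesis using p(1) assms(3) by (simp add: awalk_def)
  next
    case (2 a)
    then have "adj G x y" using p(1) by (auto simp: awalk_def adj_def)
    then show ?thesis using assms by (simp add: near_def)
  next
    case (3 a b)
    then have "adj G x (head G a)" "adj G (head G a) y" "head G a \<in> verts G"
      using p(1) by (auto simp: awalk_def adj_def)
    then show ?thesis using assms by (auto simp: near_def)
  qed
qed

lemma awalk_through:
  assumes "xs \<noteq> []" "set xs \<subseteq> verts G" "\<And>i. Suc i < length xs \<Longrightarrow> adj G (xs ! i) (xs ! Suc i)"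
  shows "\<exists>p. awalk (hd xs) p (last xs) \<and> awalk_verts (hd xs) p = xs"
  using assms
proof (induction xs rule: list_nonempty_induct)
  case (single x)
  then show ?case by (intro exI[of _ "[]"]) (auto simp: awalk_def)
next
  case (cons x xs)
  have "adj G (xs ! i) (xs ! Suc i)" if "Suc i < length xs" for i
    using cons.prems(2)[of "Suc i"] that by simp
  then obtain p where p: "awalk (hd xs) p (last xs)" "awalk_verts (hd xs) p = xs"
    using cons.IH cons.prems(1) by auto
  have "adj G x (hd xs)" using cons.prems(2)[of 0] cons.hyps by (simp add: hd_conv_nth)
  then obtain a where "a \<in> arcs G" "tail G a = x" "head G a = hd xs" by (auto simp: adj_def)
  then show ?case using p cons.hyps cons.prems(1)
    by (intro exI[of _ "a # p"]) (auto simp: awalk_def)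
qed

lemma girth_le_length:
  assumes "distinct xs" "3 \<le> length xs" "set xs \<subseteq> verts G"
    "\<And>i. Suc i < length xs \<Longrightarrow> adj G (xs ! i) (xs ! Suc i)" "adj G (last xs) (hd xs)"
  shows "girth G \<le> enat (length xs)"
proof -
  have ne: "xs \<noteq> []" using assms(2) by auto
  obtain p where p: "awalk (hd xs) p (last xs)" "awalk_verts (hd xs) p = xs"
    using awalk_through[OF ne assms(3,4)] by blast
  obtain a where a: "a \<in> arcs G" "tail G a = last xs" "head G a = hd xs"
    using assms(5) by (auto simp: adj_def)
  have aw: "awalk (last xs) [a] (hd xs)" using a tail_in_verts[OF a(1)] by (simp add: awalk_def)
  have walk: "awalk (hd xs) (p @ [a]) (hd xs)" using awalk_appendI[OF p(1) aw] .
  have "awalk_verts (hd xs) (p @ [a]) = xs @ [hd xs]"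
    using awalk_verts_append[OF walk] p a by (simp add: awlast_if_cas awalk_def)
  moreover have "distinct (tl (xs @ [hd xs]))"
    using ne assms(1) by (cases xs) auto
  ultimately have "cycle (p @ [a])" unfolding cycle_def using walk by (metis append_is_Nil_conv list.discI)
  moreover have "length (p @ [a]) = length xs"
    using p(2) length_awalk_verts[of "hd xs" p] by simp
  ultimately show ?thesis
    unfolding girth_def using assms(2) by (metis (mono_tags, lifting) INF_lower mem_Collect_eq)
qed

lemma finite_edges_in: "W \<subseteq> verts G \<Longrightarrow> finite (edges_in G W)"
proof -
  assume "W \<subseteq> verts G"
  then have "edges_in G W \<subseteq> Pow (verts G)" by (auto simp: edges_in_def)
  then show ?thesis using finite_verts by (meson finite_Pow_iff finite_subset)
qed

lemma sum_neighbours_le: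
  assumes "W \<subseteq> verts G"
  shows "(\<Sum>v\<in>W. card (nbhd (adj G) W v)) \<le> 2 * card (edges_in G W)"
proof -
  have finW: "finite W" using assms finite_verts finite_subset by blast
  note finE = finite_edges_in[OF assms]
  have "(\<Sum>v\<in>W. card (nbhd (adj G) W v)) \<le> (\<Sum>v\<in>W. card {e \<in> edges_in G W. v \<in> e})"
  proof (rule sum_mono)
    fix v assume "v \<in> W"
    then have "(\<lambda>u. {v, u}) ` nbhd (adj G) W v \<subseteq> {e \<in> edges_in G W. v \<in> e}"
      by (auto simp: nbhd_def edges_in_def)
    moreover have "inj_on (\<lambda>u. {v, u}) (nbhd (adj G) W v)"
      by (auto simp: inj_on_def doubleton_eq_iff)
    ultimately show "card (nbhd (adj G) W v) \<le> card {e \<in> edges_in G W. v \<in> e}"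
      using finE by (intro card_inj_on_le) auto
  qed
  also have "\<dots> = (\<Sum>v\<in>W. \<Sum>e\<in>{e \<in> edges_in G W. v \<in> e}. 1)" by simp
  also have "\<dots> = (\<Sum>e\<in>edges_in G W. \<Sum>v\<in>{v \<in> W. v \<in> e}. 1)"
    by (rule sum.swap_restrict[OF finW finE])
  also have "\<dots> = (\<Sum>e\<in>edges_in G W. card {v \<in> W. v \<in> e})" by simp
  also have "\<dots> \<le> (\<Sum>e\<in>edges_in G W. 2)"
  proof (rule sum_mono)
    fix e assume "e \<in> edges_in G W"
    then obtain x y where "e = {x, y}" by (auto simp: edges_in_def)
    then have "{v \<in> W. v \<in> e} \<subseteq> {x, y}" by blast
    then have "card {v \<in> W. v \<in> e} \<le> card {x, y}" by (intro card_mono) auto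
    also have "\<dots> \<le> 2" by (simp add: card_insert_if)
    finally show "card {v \<in> W. v \<in> e} \<le> 2" .
  qed
  finally show ?thesis by simp
qed

lemma plane_graph_edges_in:
  assumes draw: "plane_drawing G f c" and W: "W \<subseteq> verts G"
  shows "plane_graph W f (edges_in G W) (curve_of G c)"
proof -
  have inj: "inj_on f (verts G)" using draw by (simp add: plane_drawing_def)
  have rep: "\<exists>a\<in>arcs G. {tail G a, head G a} = e \<and> curve_of G c e = path_image (c a)"
    if e: "e \<in> edges_in G W" for e
  proof -
    have "\<exists>a. a \<in> arcs G \<and> {tail G a, head G a} = e"
      using e by (auto simp: edges_in_def adj_def)
    from someI_ex[OF this] show ?thesis unfolding curve_of_def by blast
  qed
  have eW: "e \<subseteq> W" if "e \<in> edges_in G W" for e using that by (auto simp: edges_in_def)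
  have im: "curve_of G c e \<inter> f ` verts G = f ` e" if e: "e \<in> edges_in G W" for e
  proof -
    obtain a where a: "a \<in> arcs G" "{tail G a, head G a} = e" "curve_of G c e = path_image (c a)"
      using rep[OF e] by blast
    then have "path_image (c a) \<inter> f ` verts G = {f (tail G a), f (head G a)}"
      using draw by (simp add: plane_drawing_def)
    then show ?thesis using a(2,3) by auto
  qed
  show ?thesis
  proof
    show "finite W" using W finite_verts by (rule finite_subset)
    show "inj_on f W" using inj W by (rule inj_on_subset)
    show "finite (edges_in G W)" by (rule finite_edges_in[OF W])
    fix e assume e: "e \<in> edges_in G W"
    obtain a where a: "a \<in> arcs G" "{tail G a, head G a} = e" "curve_of G c e = path_image (c a)"
      using rep[OF e] by blast
    have "Path_Connected.arc (c a)" "pathstart (c a) = f (tail G a)" "pathfinish (c a) = f (head G a)"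
      using draw a(1) by (simp_all add: plane_drawing_def)
    then show "\<exists>p q g. p \<in> W \<and> q \<in> W \<and> p \<noteq> q \<and> e = {p, q} \<and> Path_Connected.arc g \<and>
        pathstart g = f p \<and> pathfinish g = f q \<and> path_image g = curve_of G c e"
      using a no_loops[OF a(1)] eW[OF e]
      by (intro exI[of _ "tail G a"] exI[of _ "head G a"] exI[of _ "c a"]) auto
    show "curve_of G c e \<inter> f ` W = f ` e" using im[OF e] eW[OF e] W by blast
    fix e' assume e': "e' \<in> edges_in G W" "e \<noteq> e'"
    obtain a' where a': "a' \<in> arcs G" "{tail G a', head G a'} = e'" "curve_of G c e' = path_image (c a')"
      using rep[OF e'(1)] by blast
    have "{tail G a, head G a} \<noteq> {tail G a', head G a'}" using a(2) a'(2) e'(2) by simp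
    then have "path_image (c a) \<inter> path_image (c a') \<subseteq> f ` verts G"
      using draw a(1) a'(1) unfolding plane_drawing_def by blast
    then have "curve_of G c e \<inter> curve_of G c e' \<subseteq> f ` e" using im[OF e] a(3) a'(3) by blast
    then show "curve_of G c e \<inter> curve_of G c e' \<subseteq> f ` W" using eW[OF e] by blast
  qed
qed

text \<open>
  An induced subgraph inherits the drawing and the girth; its degree sum is twice its number of
  edges.
\<close>
lemma planar_girth_8_sparse:
  assumes "planar G" "girth G \<ge> 8" "W \<subseteq> verts G" "W \<noteq> {}"
  shows "3 * (\<Sum>v\<in>W. card (nbhd (adj G) W v)) < 8 * card W"
proof -
  obtain f c where draw: "plane_drawing G f c" using assms(1) by (auto simp: planar_def)
  interpret plane_graph W f "edges_in G W" "curve_of G c"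
    by (rule plane_graph_edges_in[OF draw assms(3)])
  have adj: "x \<in> W \<and> y \<in> W \<and> adj G x y" if "{x, y} \<in> edges_in G W" for x y
  proof -
    obtain u w where "{x, y} = {u, w}" "u \<in> W" "w \<in> W" "adj G u w"
      using \<open>{x, y} \<in> edges_in G W\<close> by (auto simp: edges_in_def)
    moreover from this have "adj G w u" using adj_symp by (blast dest: sympD)
    ultimately show ?thesis by (auto simp: doubleton_eq_iff)
  qed
  have "card (edges_in G W) < card W \<or>
      8 * (card (edges_in G W) + 2) \<le> 8 * card W + 2 * card (edges_in G W)"
  proof (rule plane_graph_edge_bound)
    fix xs :: "'a list"
    assume xs: "distinct xs" "3 \<le> length xs" "{hd xs, last xs} \<in> edges_in G W"
      and step: "\<And>i. Suc i < length xs \<Longrightarrow> {xs ! i, xs ! Suc i} \<in> edges_in G W"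
    have "set xs \<subseteq> W"
    proof
      fix x assume "x \<in> set xs"
      then obtain i where i: "i < length xs" "x = xs ! i" by (auto simp: in_set_conv_nth)
      show "x \<in> W"
      proof (cases "Suc i < length xs")
        case True
        then show ?thesis using adj[OF step[OF True]] i by blast
      next
        case False
        then have "i = length xs - 1" "xs \<noteq> []" using i by auto
        then have "x = last xs" using i by (simp add: last_conv_nth)
        then show ?thesis using adj[OF xs(3)] by blast
      qed
    qed
    then have "set xs \<subseteq> verts G" using assms(3) by (rule subset_trans)
    moreover have "adj G (xs ! i) (xs ! Suc i)" if "Suc i < length xs" for i
      using adj[OF step[OF that]] by blast
    moreover have "adj G (last xs) (hd xs)" using adj[OF xs(3)] adj_symp by (blast dest: sympD)
    ultimately have "girth G \<le> enat (length xs)" by (rule girth_le_length[OF xs(1,2)])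
    then have "8 \<le> enat (length xs)" using assms(2) by (rule order_trans[rotated])
    then show "8 \<le> length xs" by (simp add: numeral_eq_enat)
  qed (rule assms(4))
  moreover have "0 < card W" using assms(4) finP by (simp add: card_gt_0_iff)
  ultimately have "3 * card (edges_in G W) < 4 * card W" by auto
  then show ?thesis using sum_neighbours_le[OF assms(3)] by linarith
qed

end

theorem corollary5:
  fixes G :: "('a, 'b) pre_digraph"
  assumes "Digraph.graph G"
    and "planar G"
    and "girth G \<ge> 8"
    and "max_degree G \<ge> 6"
  shows "\<exists>\<phi>. two_distance_coloring G (max_degree G + 2) \<phi>"
proof -
  interpret Digraph.graph G by (rule assms(1))
  have "colorable (adj G) (verts G) (max_degree G + 2)"
    using adj_symp adj_irrefl finite_verts assms(4) card_neighbours_le planar_girth_8_sparse[OF assms(2,3)]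
    by (rule sparse_colorable)
  then obtain \<phi> where \<phi>: "partial_coloring (adj G) (verts G) (max_degree G + 2) (verts G) \<phi>"
    by (auto simp: colorable_def)
  have "two_distance_coloring G (max_degree G + 2) (\<lambda>x. Suc (\<phi> x))"
    unfolding two_distance_coloring_def
  proof (intro conjI ballI impI)
    show "(\<lambda>x. Suc (\<phi> x)) ` verts G \<subseteq> {1..max_degree G + 2}"
      using \<phi> by (auto simp: partial_coloring_def Suc_le_eq)
    fix x y assume xy: "x \<in> verts G" "y \<in> verts G" "x \<noteq> y \<and> graph_dist G x y \<le> 2"
    then have "y \<in> near (adj G) (verts G) x" using near_if_dist_le_2 by blast
    then show "Suc (\<phi> x) \<noteq> Suc (\<phi> y)" using \<phi> xy by (auto simp: partial_coloring_def)
  qed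
  then show ?thesis by blast
qed

end
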